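(* Let $t,u\in\mathbb{Z}$, $D=t^2-4u$, and $n\in\mathbb{N}$ with $u\equiv1\bmod n$ and $u+1\equiv t\bmod n^2$. Let $\ell$ be a prime. (a) For $r\ge1$ and any integer $u'\equiv u\bmod \ell^{\nu_\ell(D)+1}$, \[ \#C(t,u',1;\ell^r)=\ell^{2r}+\ell^{2r}\sum_{j=1}^{\min\{r,\nu_\ell(D)+1\}}\frac{N_D(\ell^j)-N_D(\ell^{j-1})}{\ell^j}. \] If in addition $r>\nu_\ell(D)$, then \[ \frac{\ell^r\phi(\ell^r)\cdot|C(t,u',1;\ell^r)|}{|\mathrm{GL}_2(\mathbb{Z}/\ell^r\mathbb{Z})|}=\left(1+\frac1\ell\right)^{-1}\sum_{j=0}^\infty\frac{N_D(\ell^j)}{\ell^j}. \] In particular the limit defining $f_\ell(t,u,1)$ exists and equals the right-hand side of this identity. (b) The sequence in $r$ whose limit defines $f_\ell(t,u,n)$ is constant for $r>\nu_\ell(D)$; in particular $f_\ell(t,u,n)$ is well defined. Moreover, with $t_1=(t-2)/n$ and $u_1=(u+1-t)/n^2$, \[ f_\ell(t,u,n)=\frac{f_\ell(t_1,u_1,1)}{\ell^{\nu_\ell(n)}}\quad\text{and}\quad f_\ell(t,u,n)-f_\ell(t,u,\ell n)=\frac{f^*_\ell(t_1,u_1,1)}{\ell^{\nu_\ell(n)}}, \] and the sequence in $r$ defining $f^*_\ell(t_1,u_1,1)$ is constant for $r>\nu_\ell(t_1^2-4u_1)$. (c) If $\ell\nmid D/n^2$, then $f_\ell(t,u,\ell n)=0$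 and \[ f_\ell(t,u,n)=\frac{1}{\ell^{\nu_\ell(n)}}\left(1-\frac1{\ell^2}\right)^{-1}\left(1+\frac{\left(\frac{D/n^2}{\ell}\right)}{\ell}\right). \] (d) For every $r\ge1$, $\#C(t,u,n;\ell^r)=\ell^{2r-\nu_\ell(n)}+O(\ell^{2r-\nu_\ell(n)-1})$.
   Context: $\nu_\ell$ denotes the $\ell$-adic valuation and $\left(\frac{\cdot}{\ell}\right)$ the Kronecker symbol. For $d\in\mathbb{Z}$, $m\in\mathbb{N}$, $N_d(m):=\#\{0\le x<2m:x^2\equiv d\bmod 4m\}$. For integers $t,u$, $n\in\mathbb{N}$, a prime $\ell$ and $r\ge1$, \[ C(t,u,n;\ell^r):=\{\sigma\in M_2(\mathbb{Z}/\ell^r\mathbb{Z}):\mathrm{tr}(\sigma)\equiv t\bmod \ell^r,\ \det(\sigma)\equiv u\bmod\ell^r,\ \sigma\equiv I\bmod \ell^{\nu_\ell(n)}\}, \] and $f_\ell(t,u,n):=\lim_{r\to\infty}\frac{\ell^r\phi(\ell^r)\,|C(t,u,n;\ell^r)|}{|\mathrm{GL}_2(\mathbb{Z}/\ell^r\mathbb{Z})|}$. The quantity $f^*_\ell(t_1,u_1,1)$ is defined as $f_\ell(t_1,u_1,1)$ but with $|C(t_1,u_1,1;\ell^r)|$ replaced by $\#\{\sigma\in C(t_1,u_1,1;\ell^r):\sigma\not\equiv 0\bmod \ell\}$.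
   Formalization: In (d) the implied constant is absolute only for r ≥ 2ν_ℓ(n); for all r ≥ 1 it may depend on n. With an absolute constant for all r the claim fails: t=2, u=1, n=ℓ, r=1 gives #C=1, not ℓ+O(1). *)

theory Defs
  imports
    "HOL-Analysis.Determinants"
    "HOL-Number_Theory.Number_Theory"
    "HOL-Library.Extended_Nat"
begin

text \<open>The valuation is extended-valued because \<open>multiplicity l 0 = 0\<close>,
  whereas the valuation of 0 is infinite.\<close>

definition val :: "nat \<Rightarrow> int \<Rightarrow> enat" where
  "val l a = (if a = 0 then \<infinity> else enat (multiplicity (int l) a))"

text \<open>Congruence modulo \<open>l\<close> to the power \<open>e\<close>; for \<open>e = \<infinity>\<close> (and \<open>l \<ge> 2\<close>) this is equality.\<close>

definition cong_pow :: "nat \<Rightarrow> enat \<Rightarrow> int \<Rightarrow> int \<Rightarrow> bool" where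
  "cong_pow l e a b \<longleftrightarrow> (\<forall>k::nat. enat k \<le> e \<longrightarrow> [a = b] (mod int l ^ k))"

text \<open>The Kronecker symbol with prime lower argument.\<close>

definition kronecker :: "int \<Rightarrow> nat \<Rightarrow> int" where
  "kronecker a l =
     (if l = 2 then (if even a then 0 else if a mod 8 = 1 \<or> a mod 8 = 7 then 1 else - 1)
      else Legendre a (int l))"

definition num_sqrt :: "int \<Rightarrow> nat \<Rightarrow> nat" where
  "num_sqrt d m = card {x::int. 0 \<le> x \<and> x < 2 * int m \<and> [x\<^sup>2 = d] (mod (4 * int m))}"

text \<open>Matrices over \<open>\<int>/m\<int>\<close> are integer matrices with entries in the residue system \<open>{0..<m}\<close>.\<close>

definition mat2_mod :: "nat \<Rightarrow> (int^2^2) set" where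
  "mat2_mod m = {A. \<forall>i j. 0 \<le> A $ i $ j \<and> A $ i $ j < int m}"

definition mat_cong :: "nat \<Rightarrow> int^2^2 \<Rightarrow> int^2^2 \<Rightarrow> bool" where
  "mat_cong m A B \<longleftrightarrow> (\<forall>i j. [A $ i $ j = B $ i $ j] (mod int m))"

definition GL2_mod :: "nat \<Rightarrow> (int^2^2) set" where
  "GL2_mod m =
     {A \<in> mat2_mod m. \<exists>B \<in> mat2_mod m. mat_cong m (A ** B) (mat 1) \<and> mat_cong m (B ** A) (mat 1)}"

text \<open>In \<open>\<int>/l\<^sup>r\<int>\<close> the ideal generated by \<open>l\<^sup>k\<close> is that of \<open>l\<close> to the power \<open>min r k\<close>; hence
  the minimum, which makes the last condition independent of representatives when \<open>r < k\<close>.\<close>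

definition C_set :: "int \<Rightarrow> int \<Rightarrow> nat \<Rightarrow> nat \<Rightarrow> nat \<Rightarrow> (int^2^2) set" where
  "C_set t u n l r =
     {A \<in> mat2_mod (l ^ r). [trace A = t] (mod int (l ^ r)) \<and> [det A = u] (mod int (l ^ r)) \<and>
        mat_cong (l ^ min r (multiplicity l n)) A (mat 1)}"

definition f_seq :: "int \<Rightarrow> int \<Rightarrow> nat \<Rightarrow> nat \<Rightarrow> nat \<Rightarrow> real" where
  "f_seq t u n l r =
     real (l ^ r) * real (totient (l ^ r)) * real (card (C_set t u n l r)) /
     real (card (GL2_mod (l ^ r)))"

definition f_loc :: "int \<Rightarrow> int \<Rightarrow> nat \<Rightarrow> nat \<Rightarrow> real" where
  "f_loc t u n l = lim (\<lambda>r. f_seq t u n l r)"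

definition fstar_seq :: "int \<Rightarrow> int \<Rightarrow> nat \<Rightarrow> nat \<Rightarrow> real" where
  "fstar_seq t u l r =
     real (l ^ r) * real (totient (l ^ r)) *
     real (card {A \<in> C_set t u 1 l r. \<not> mat_cong l A (mat 0)}) /
     real (card (GL2_mod (l ^ r)))"

definition fstar_loc :: "int \<Rightarrow> int \<Rightarrow> nat \<Rightarrow> real" where
  "fstar_loc t u l = lim (\<lambda>r. fstar_seq t u l r)"

definition const_beyond :: "enat \<Rightarrow> (nat \<Rightarrow> real) \<Rightarrow> bool" where
  "const_beyond e s \<longleftrightarrow> (\<forall>r r'. e < enat r \<and> e < enat r' \<longrightarrow> s r = s r')"

end

theory Submission
  imports Defs
begin

text \<open>Subtracting the identity from a matrix that is \<open>1\<close> modulo \<open>n\<close> and dividing by \<open>n\<close> turns trace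
  and determinant \<open>(t, u)\<close> into \<open>(t\<^sub>1, u\<^sub>1)\<close> and loses only a power of \<open>\<ell>\<close>, so everything reduces to
  \<open>n = 1\<close>, and the matrices divisible by \<open>\<ell>\<close> that \<open>f\<^sup>*\<close> leaves out are handled by the same scaling.
  For \<open>n = 1\<close> a matrix of trace \<open>t\<close> is given by its diagonal entry \<open>a\<close> and off-diagonal entries \<open>b, c\<close>
  with \<open>b c \<equiv> - (a\<^sup>2 - t a + u)\<close> modulo \<open>\<ell>\<^sup>r\<close>. The number of pairs \<open>(b, c)\<close> depends only on which
  \<open>\<ell>\<^sup>i\<close> divide \<open>a\<^sup>2 - t a + u\<close>, so the count is a combination of the numbers of roots of this quadratic
  modulo \<open>\<ell>\<^sup>i\<close>, which completing the square identifies with \<open>N\<^sub>D(\<ell>\<^sup>i)\<close>. By Hensel lifting these are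
  constant for \<open>i > \<nu>\<^sub>\<ell>(D)\<close>, and in general they are at most \<open>2 \<ell>\<^sup>i\<^sup>/\<^sup>2\<close>, since the difference of two
  roots or its reflection must be divisible by \<open>\<ell>\<^sup>i\<^sup>/\<^sup>2\<close>. The latter bound gives the convergence when \<open>D = 0\<close>
  and the uniform constant in (d).\<close>

section \<open>Sums over residue systems\<close>

text \<open>Indicator sums must stay sums: rewriting them to cardinalities or restricted sums would
  block the periodicity arguments.\<close>

declare sum_of_bool_eq [simp del] sum_mult_of_bool_eq [simp del] sum_of_bool_mult_eq [simp del]

text \<open>A function on the integers modulo \<open>m\<close>, kept as a function on integers so
  that affine substitutions need no reduction inside its argument.\<close>

definition periodic :: "int \<Rightarrow> (int \<Rightarrow> 'a) \<Rightarrow> bool" where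
  "periodic m g \<longleftrightarrow> (\<forall>x y. [x = y] (mod m) \<longrightarrow> g x = g y)"

lemma periodicI: "(\<And>x y. [x = y] (mod m) \<Longrightarrow> g x = g y) \<Longrightarrow> periodic m g"
  by (simp add: periodic_def)

lemma periodicD: "periodic m g \<Longrightarrow> [x = y] (mod m) \<Longrightarrow> g x = g y"
  by (simp add: periodic_def)

lemma sum_periodic_shift:
  fixes g :: "int \<Rightarrow> real"
  assumes "m > 0" "periodic m g"
  shows "(\<Sum>x\<in>{0..<m}. g (x + c)) = (\<Sum>x\<in>{0..<m}. g x)"
proof (rule sum.reindex_bij_witness[where i = "\<lambda>y. (y - c) mod m" and j = "\<lambda>x. (x + c) mod m"])
  fix x assume "x \<in> {0..<m}"
  then show "((x + c) mod m - c) mod m = x" "((x - c) mod m + c) mod m = x"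
    by (simp_all add: mod_diff_left_eq mod_add_left_eq)
  show "g ((x + c) mod m) = g (x + c)"
    by (rule periodicD[OF assms(2)]) (simp add: cong_def)
qed (use assms in auto)

lemma sum_periodic_scale:
  fixes g :: "int \<Rightarrow> real"
  assumes "m > 0" "periodic m g" "coprime k m"
  shows "(\<Sum>x\<in>{0..<m}. g (k * x)) = (\<Sum>x\<in>{0..<m}. g x)"
proof -
  obtain k' where k': "[k * k' = 1] (mod m)"
    using assms(3) cong_solve_coprime_int by blast
  have inv: "k * (k' * x) mod m = x" "k' * (k * x) mod m = x" if "x \<in> {0..<m}" for x
  proof -
    have "[k * k' * x = 1 * x] (mod m)" using k' cong_scalar_right by blast
    then show "k * (k' * x) mod m = x" "k' * (k * x) mod m = x"
      using that by (simp_all add: cong_def mult_ac)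
  qed
  show ?thesis
  proof (rule sum.reindex_bij_witness[where i = "\<lambda>y. (k' * y) mod m" and j = "\<lambda>x. (k * x) mod m"])
    fix x assume "x \<in> {0..<m}"
    then show "k' * (k * x mod m) mod m = x" "k * (k' * x mod m) mod m = x"
      using inv by (simp_all add: mod_mult_right_eq)
    show "g ((k * x) mod m) = g (k * x)"
      by (rule periodicD[OF assms(2)]) (simp add: cong_def)
  qed (use assms in auto)
qed

lemma sum_periodic_multiple:
  fixes g :: "int \<Rightarrow> real"
  assumes "m > 0" "k \<ge> 0" "periodic m g"
  shows "(\<Sum>x\<in>{0..<k * m}. g x) = of_int k * (\<Sum>x\<in>{0..<m}. g x)"
proof -
  have "(\<Sum>x\<in>{0..<k * m}. g x) = (\<Sum>(q, x)\<in>{0..<k} \<times> {0..<m}. g x)"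
  proof (rule sum.reindex_bij_witness[where j = "\<lambda>x. (x div m, x mod m)" and i = "\<lambda>(q, x). q * m + x"])
    fix x assume x: "x \<in> {0..<k * m}"
    then have "x div m < k"
      using assms(1) pos_mod_sign[of m x] div_mult_mod_eq[of x m]
      by (smt (verit) atLeastLessThan_iff mult_right_mono)
    then show "(x div m, x mod m) \<in> {0..<k} \<times> {0..<m}"
      using x assms(1) by (simp add: pos_imp_zdiv_nonneg_iff)
    show "(case (x div m, x mod m) of (q, x) \<Rightarrow> g x) = g x"
      by (simp, rule periodicD[OF assms(3)]) (simp add: cong_def)
  next
    fix p assume p: "p \<in> {0..<k} \<times> {0..<m}"
    obtain q x where qx: "p = (q, x)" by (cases p)
    with p have *: "0 \<le> q" "q + 1 \<le> k" "0 \<le> x" "x < m" by auto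
    show "((case p of (q, x) \<Rightarrow> q * m + x) div m, (case p of (q, x) \<Rightarrow> q * m + x) mod m) = p"
      using * by (simp add: qx)
    have "(q + 1) * m \<le> k * m" using * by (intro mult_right_mono) auto
    then show "(case p of (q, x) \<Rightarrow> q * m + x) \<in> {0..<k * m}"
      using * by (simp add: qx algebra_simps)
  qed simp
  also have "\<dots> = of_int k * (\<Sum>x\<in>{0..<m}. g x)"
    using assms(2) by (simp flip: sum.cartesian_product)
  finally show ?thesis .
qed

lemma sum_multiples:
  fixes g :: "int \<Rightarrow> real"
  assumes "k > 0"
  shows "(\<Sum>x\<in>{0..<k * m}. of_bool (k dvd x) * g x) = (\<Sum>x\<in>{0..<m}. g (k * x))"
proof -
  have "(\<Sum>x\<in>{0..<k * m}. of_bool (k dvd x) * g x) = (\<Sum>x\<in>{x\<in>{0..<k * m}. k dvd x}. g x)"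
    by (rule sum.mono_neutral_cong_right) auto
  also have "\<dots> = (\<Sum>x\<in>{0..<m}. g (k * x))"
    by (rule sum.reindex_bij_witness[where i = "\<lambda>x. k * x" and j = "\<lambda>x. x div k"])
      (use assms in \<open>auto simp: zero_le_mult_iff\<close>)
  finally show ?thesis .
qed

text \<open>Eliminates a variable that a congruence determines, such as the second diagonal entry of
  a matrix of given trace.\<close>

lemma sum_residue_class:
  fixes g :: "int \<Rightarrow> real"
  assumes "m > 0" "periodic m g"
  shows "(\<Sum>x\<in>{0..<m}. of_bool (m dvd x - c) * g x) = g c"
proof -
  have "(\<Sum>x\<in>{0..<m}. of_bool (m dvd x - c) * g x) = (\<Sum>x\<in>{c mod m}. g x)"
  proof (rule sum.mono_neutral_cong_right)
    show "\<forall>x\<in>{0..<m} - {c mod m}. of_bool (m dvd x - c) * g x = 0"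
      by (auto simp: mod_eq_dvd_iff[symmetric])
  qed (use assms in \<open>auto simp: mod_eq_dvd_iff[symmetric]\<close>)
  also have "\<dots> = g c"
    by (simp, rule periodicD[OF assms(2)]) (simp add: cong_def)
  finally show ?thesis .
qed

lemma periodic_dvd_diff:
  "k dvd m \<Longrightarrow> periodic m (\<lambda>x. of_bool (k dvd x - c) :: real)"
  by (intro periodicI arg_cong[where f = of_bool] cong_dvd_iff cong_diff cong_refl) (rule cong_dvd_modulus)

lemma sum_residue_class_count:
  fixes m :: int
  assumes "m > 0"
  shows "(\<Sum>x\<in>{0..<m}. of_bool (m dvd x - c)) = (1::real)"
  using sum_residue_class[OF assms, of "\<lambda>_. 1" c] by (simp add: periodic_def)

lemma sum_linear_congruence:
  fixes m :: int
  assumes "m > 0" "coprime k m"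
  shows "(\<Sum>x\<in>{0..<m}. of_bool (m dvd k * x - c)) = (1::real)"
proof -
  have "periodic m (\<lambda>x. of_bool (m dvd x - c) :: real)"
    by (rule periodic_dvd_diff) simp
  from sum_periodic_scale[OF assms(1) this assms(2)] sum_residue_class_count[OF assms(1), of c]
  show ?thesis by simp
qed

lemma periodic_of_bool:
  assumes "\<And>x y. [x = y] (mod m) \<Longrightarrow> P x \<Longrightarrow> P y"
  shows "periodic m (\<lambda>x. of_bool (P x) :: real)"
proof (rule periodicI)
  fix x y assume "[x = y] (mod m)"
  then have "P x = P y" using assms cong_sym by blast
  then show "of_bool (P x) = (of_bool (P y) :: real)" by simp
qed

section \<open>Roots of a quadratic modulo prime powers\<close>

text \<open>The quadratic is the characteristic polynomial of a matrix of trace \<open>t\<close> and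
  determinant \<open>u\<close>. The count is real because it enters as a density.\<close>

definition root_count :: "int \<Rightarrow> int \<Rightarrow> int \<Rightarrow> real" where
  "root_count t u m = (\<Sum>a\<in>{0..<m}. of_bool (m dvd a\<^sup>2 - t * a + u))"

lemma cong_quadratic: "[x = y] (mod m) \<Longrightarrow> [x\<^sup>2 - t * x + u = y\<^sup>2 - t * y + u] (mod m)" for m :: int
  by (intro cong_add cong_diff cong_pow cong_mult cong_refl)

lemma periodic_quadratic:
  "k dvd m \<Longrightarrow> periodic m (\<lambda>x. of_bool (k dvd x\<^sup>2 - t * x + u) :: real)"
  by (intro periodicI arg_cong[where f = of_bool] cong_dvd_iff cong_quadratic) (rule cong_dvd_modulus)

lemma root_count_1 [simp]: "root_count t u 1 = 1"
  by (simp add: root_count_def atLeastLessThan_singleton)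

lemma root_count_nonneg: "root_count t u m \<ge> 0"
  by (simp add: root_count_def sum_nonneg)

lemma root_count_cong:
  assumes "[u = u'] (mod m)"
  shows "root_count t u m = root_count t u' m"
  unfolding root_count_def
  by (intro sum.cong refl arg_cong[where f = of_bool] cong_dvd_iff cong_add cong_refl assms)

lemma root_count_multiple:
  assumes "m > 0" "k \<ge> 0"
  shows "(\<Sum>a\<in>{0..<k * m}. of_bool (m dvd a\<^sup>2 - t * a + u)) = of_int k * root_count t u m"
  unfolding root_count_def by (rule sum_periodic_multiple[OF assms periodic_quadratic]) simp

lemma num_sqrt_eq_root_count:
  assumes "m > 0"
  shows "real (num_sqrt (t\<^sup>2 - 4 * u) m) = root_count t u (int m)"
proof -
  define M where "M = int m"
  define D where "D = t\<^sup>2 - 4 * u"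
  define g where "g = (\<lambda>x. of_bool (4 * M dvd x\<^sup>2 - D) :: real)"
  have M: "M > 0" using assms by (simp add: M_def)
  have per: "periodic (2 * M) g"
    unfolding g_def
  proof (rule periodic_of_bool)
    fix x y assume "[x = y] (mod 2 * M)" and x: "4 * M dvd x\<^sup>2 - D"
    then obtain q where q: "y = x + 2 * M * q" by (metis cong_iff_lin)
    have "y\<^sup>2 - D = (x\<^sup>2 - D) + 4 * M * (q * x + M * q\<^sup>2)"
      unfolding q by (simp add: power2_eq_square algebra_simps)
    then show "4 * M dvd y\<^sup>2 - D" using x by (simp only: dvd_add_left_iff dvd_triv_left)
  qed
  \<comment> \<open>Substitute \<open>x = 2 a - t\<close>: the congruence modulo \<open>4\<close> forces \<open>x\<close> to have the parity of \<open>t\<close>.\<close>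
  have "{x. 0 \<le> x \<and> x < 2 * M \<and> [x\<^sup>2 = D] (mod (4 * M))} = {x\<in>{0..<2 * M}. 4 * M dvd x\<^sup>2 - D}"
    by (auto simp: cong_iff_dvd_diff)
  then have "real (num_sqrt D m) = (\<Sum>x\<in>{0..<2 * M}. g x)"
    by (simp add: num_sqrt_def M_def[symmetric] g_def Int_def sum_of_bool_eq)
  also have "\<dots> = (\<Sum>x\<in>{0..<2 * M}. g (x + (- t)))"
    using M per by (subst sum_periodic_shift) auto
  also have "\<dots> = (\<Sum>x\<in>{0..<2 * M}. of_bool (2 dvd x) * g (x + (- t)))"
  proof (rule sum.cong)
    fix x
    have "even x" if "4 * M dvd (x - t)\<^sup>2 - D"
    proof -
      have "4 dvd (x - t)\<^sup>2 - D" using that by (rule dvd_mult_left)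
      then have "even ((x - t)\<^sup>2 - D)" by (rule dvd_trans[rotated]) simp
      then show ?thesis by (auto simp: D_def)
    qed
    then show "g (x + (- t)) = of_bool (2 dvd x) * g (x + (- t))"
      by (auto simp: g_def)
  qed simp
  also have "\<dots> = (\<Sum>x\<in>{0..<M}. g (2 * x + (- t)))"
    by (rule sum_multiples) simp
  also have "\<dots> = root_count t u M"
    unfolding root_count_def g_def
  proof (intro sum.cong arg_cong[where f = of_bool] refl)
    fix x
    have "(2 * x + (- t))\<^sup>2 - D = 4 * (x\<^sup>2 - t * x + u)"
      by (simp add: D_def power2_eq_square algebra_simps)
    then show "(4 * M dvd (2 * x + (- t))\<^sup>2 - D) = (M dvd x\<^sup>2 - t * x + u)"
      by (simp only: dvd_mult_cancel_left) simp
  qed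
  finally show ?thesis by (simp add: D_def M_def)
qed

text \<open>Given one root \<open>a\<close>, every root \<open>x\<close> satisfies
  \<open>(x - a) * (x - (t - a))\<close> congruent to 0, so half of the prime power divides one
  factor. This leaves two residue classes modulo \<open>l ^ p\<close>, with \<open>p\<close> being
  \<open>j / 2\<close> rounded up, and each has \<open>l ^ (j div 2)\<close> members modulo
  \<open>l ^ j\<close>.\<close>

lemma root_count_prime_power_le:
  assumes l: "prime (l::nat)"
  shows "root_count t u (int l ^ j) \<le> 2 * real l ^ (j div 2)"
proof (cases "\<exists>a. int l ^ j dvd a\<^sup>2 - t * a + u")
  case False
  then have "root_count t u (int l ^ j) = 0"
    unfolding root_count_def
    by (intro sum.neutral ballI of_bool_eq_0_iff[THEN iffD2]) blast
  then show ?thesis by simp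
next
  case True
  then obtain a where a: "int l ^ j dvd a\<^sup>2 - t * a + u" by blast
  define p where "p = j - j div 2"
  have l0: "int l > 0" using l prime_gt_0_nat by simp
  have count: "(\<Sum>x\<in>{0..<int l ^ j}. of_bool (int l ^ p dvd x - c)) = real l ^ (j div 2)" for c
  proof -
    have "periodic (int l ^ p) (\<lambda>x. of_bool (int l ^ p dvd x - c) :: real)"
      by (rule periodic_dvd_diff) simp
    then have "(\<Sum>x\<in>{0..<int l ^ (j div 2) * int l ^ p}. of_bool (int l ^ p dvd x - c))
        = of_int (int l ^ (j div 2)) * (\<Sum>x\<in>{0..<int l ^ p}. of_bool (int l ^ p dvd x - c) :: real)"
      using l0 by (intro sum_periodic_multiple) auto
    also have "int l ^ (j div 2) * int l ^ p = int l ^ j"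
      by (simp add: p_def flip: power_add)
    finally show ?thesis
      using l0 by (simp add: sum_residue_class_count)
  qed
  have "root_count t u (int l ^ j)
      \<le> (\<Sum>x\<in>{0..<int l ^ j}. of_bool (int l ^ p dvd x - a) + of_bool (int l ^ p dvd x - (t - a)))"
    unfolding root_count_def
  proof (rule sum_mono)
    fix x
    have "int l ^ p dvd x - a \<or> int l ^ p dvd x - (t - a)" if "int l ^ j dvd x\<^sup>2 - t * x + u"
    proof (cases "j = 0")
      case False
      have "int l ^ j dvd (x\<^sup>2 - t * x + u) - (a\<^sup>2 - t * a + u)"
        using that a by (rule dvd_diff)
      also have "\<dots> = (x - a) * (x - (t - a))"
        by (simp add: power2_eq_square algebra_simps)
      \<comment> \<open>Divisibility of one factor or the other by \<open>l ^ p\<close> already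
        follows from the exponent \<open>p + p - 1\<close>, which is at most \<open>j\<close> for
        both parities of \<open>j\<close>.\<close>
      finally have "int l ^ (2 * p - 1) dvd (x - a) * (x - (t - a))"
        by (rule power_le_dvd) (simp add: p_def)
      then show ?thesis
        by (rule prime_elem_power_dvd_cases) (use False l in \<open>auto simp: p_def\<close>)
    qed (simp add: p_def)
    then show "of_bool (int l ^ j dvd x\<^sup>2 - t * x + u)
      \<le> (of_bool (int l ^ p dvd x - a) + of_bool (int l ^ p dvd x - (t - a)) :: real)"
      by auto
  qed
  also have "\<dots> = 2 * real l ^ (j div 2)"
    by (simp add: sum.distrib count)
  finally show ?thesis .
qed

text \<open>The square of the derivative \<open>2 * a - t\<close> is the discriminant plus four
  times the value at \<open>a\<close>. At a root that value vanishes beyond the valuation of the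
  discriminant, so the two valuations agree.\<close>

lemma root_derivative_multiplicity:
  fixes t u a :: int
  assumes l: "prime (l::nat)" and nd: "\<not> int l ^ j dvd t\<^sup>2 - 4 * u"
    and root: "int l ^ j dvd a\<^sup>2 - t * a + u"
  shows "2 * multiplicity (int l) (2 * a - t) = multiplicity (int l) (t\<^sup>2 - 4 * u)"
proof -
  define D where "D = t\<^sup>2 - 4 * u"
  define e where "e = multiplicity (int l) D"
  have pl: "prime (int l)" using l by simp
  have nu: "\<not> is_unit (int l)" using pl not_prime_unit by blast
  have D0: "D \<noteq> 0" using nd by (auto simp: D_def)
  have ej: "e < j"
    using nd D0 nu unfolding e_def D_def by (meson not_le_imp_less multiplicity_dvd')
  have sq: "(2 * a - t)\<^sup>2 = D + 4 * (a\<^sup>2 - t * a + u)"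
    by (simp add: D_def power2_eq_square algebra_simps)
  \<comment> \<open>Both sides are congruent modulo \<open>l ^ j\<close>; since
    \<open>e < j\<close>, this can be tested at \<open>e\<close> and at \<open>Suc e\<close>, which
    pins down the valuation.\<close>
  have 1: "int l ^ k dvd (2 * a - t)\<^sup>2 \<longleftrightarrow> int l ^ k dvd D" if "k \<le> j" for k
  proof -
    have "int l ^ k dvd 4 * (a\<^sup>2 - t * a + u)"
      using root that by (meson dvd_mult dvd_trans le_imp_power_dvd)
    then show ?thesis unfolding sq by (simp only: dvd_add_left_iff)
  qed
  have "multiplicity (int l) ((2 * a - t)\<^sup>2) = e"
  proof (rule multiplicity_eqI)
    show "int l ^ e dvd (2 * a - t)\<^sup>2" using 1[of e] ej by (simp add: e_def multiplicity_dvd)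
    have "\<not> int l ^ Suc e dvd D"
      using D0 nu unfolding e_def by (metis power_dvd_iff_le_multiplicity not_less_eq_eq le_refl)
    then show "\<not> int l ^ Suc e dvd (2 * a - t)\<^sup>2" using 1[of "Suc e"] ej by simp
  qed
  moreover have "2 * a - t \<noteq> 0"
    using 1[of j] nd by (auto simp: D_def)
  ultimately show ?thesis
    using pl by (simp add: prime_elem_multiplicity_power_distrib e_def D_def)
qed

text \<open>Hensel: if \<open>l\<^sup>w\<close> exactly divides the derivative at the roots modulo \<open>m = l\<^sup>j\<close>, then along
  the shifts \<open>a + h s\<close> with \<open>h = l\<^sup>j\<^sup>-\<^sup>w\<close> the polynomial is affine in \<open>s\<close> modulo \<open>l m\<close>, so exactly
  one shift modulo \<open>l\<close> is a root modulo \<open>l m\<close>. Summing over all shifts counts these roots \<open>l\<close> times.\<close>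

lemma root_count_stable:
  fixes t u :: int
  assumes l: "prime (l::nat)" and nd: "\<not> int l ^ j dvd t\<^sup>2 - 4 * u"
  shows "root_count t u (int l ^ Suc j) = root_count t u (int l ^ j)"
proof -
  define f where "f = (\<lambda>a. a\<^sup>2 - t * a + u)"
  define m where "m = int l ^ j"
  \<comment> \<open>A root forces the valuation of the discriminant to be even, so nothing is lost
    in halving; \<open>w\<close> is read as the valuation of the derivative only at roots.\<close>
  define w where "w = multiplicity (int l) (t\<^sup>2 - 4 * u) div 2"
  define h where "h = int l ^ (j - w)"
  have l0: "int l > 0" using l prime_gt_0_nat by simp
  have pl: "prime (int l)" using l by simp
  have nu: "\<not> is_unit (int l)" using pl not_prime_unit by blast
  have D0: "t\<^sup>2 - 4 * u \<noteq> 0" using nd by auto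
  have m0: "m > 0" using l0 by (simp add: m_def)
  have "multiplicity (int l) (t\<^sup>2 - 4 * u) < j"
    using nd D0 nu by (meson not_le_imp_less multiplicity_dvd')
  then have w: "2 * w < j" unfolding w_def by linarith
  have mh: "m = int l ^ w * h" using w by (simp add: m_def h_def flip: power_add)
  \<comment> \<open>From \<open>2 * w < j\<close> follows \<open>2 * (j - w) \<ge> j + 1\<close>, so
    the quadratic term of the shift vanishes modulo \<open>l * m\<close>.\<close>
  have hh: "int l * m dvd h\<^sup>2"
    unfolding m_def h_def using w by (simp add: le_imp_power_dvd flip: power_Suc power_mult)
  have shift: "f (a + h * s) = f a + (2 * a - t) * h * s + h\<^sup>2 * s\<^sup>2" for a s
    by (simp add: f_def power2_eq_square algebra_simps)
  have deriv: "\<exists>q. 2 * a - t = int l ^ w * q \<and> coprime q (int l)" if "m dvd f a" for a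
  proof -
    have mult: "2 * multiplicity (int l) (2 * a - t) = multiplicity (int l) (t\<^sup>2 - 4 * u)"
      by (rule root_derivative_multiplicity[OF l nd]) (use that in \<open>simp add: m_def f_def\<close>)
    then have w': "multiplicity (int l) (2 * a - t) = w" by (simp add: w_def)
    have "2 * a - t \<noteq> 0"
    proof
      assume "2 * a - t = 0"
      then have "(2 * a - t)\<^sup>2 - 4 * f a = - (4 * f a)" by simp
      then have "t\<^sup>2 - 4 * u = - (4 * f a)" by (simp add: f_def power2_eq_square algebra_simps)
      then have "m dvd t\<^sup>2 - 4 * u" using that by (metis dvd_minus_iff dvd_mult)
      then show False using nd by (simp add: m_def)
    qed
    then obtain q where "2 * a - t = int l ^ w * q" "\<not> int l dvd q"
      using multiplicity_decompose'[of "2 * a - t" "int l"] nu w' by (metis mult.commute)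
    then show ?thesis using pl by (metis prime_imp_coprime coprime_commute)
  qed
  have step: "m dvd f (a + h * s)" if a: "m dvd f a" for a s
  proof -
    obtain q where q: "2 * a - t = int l ^ w * q" using deriv[OF a] by blast
    have "m dvd h\<^sup>2" using hh by (rule dvd_mult_right)
    moreover have "(2 * a - t) * h * s = m * (q * s)" by (simp add: q mh)
    ultimately show ?thesis unfolding shift using a by (intro dvd_add) auto
  qed
  \<comment> \<open>Shifting back by \<open>- s\<close> shows that only roots modulo
    \<open>m\<close> have shifts that are roots modulo \<open>l * m\<close>.\<close>
  have descend: "m dvd f a" if "int l * m dvd f (a + h * s)" for a s
    using step[OF dvd_mult_right[OF that], of "- s"] by simp
  have unique: "(\<Sum>s\<in>{0..<int l}. of_bool (int l * m dvd f (a + h * s))) = (1::real)"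
    if a: "m dvd f a" for a
  proof -
    obtain q where q: "2 * a - t = int l ^ w * q" "coprime q (int l)" using deriv[OF a] by blast
    obtain y where y: "f a = m * y" using a by blast
    have "int l * m dvd f (a + h * s) \<longleftrightarrow> int l dvd q * s - (- y)" for s
    proof -
      have "f (a + h * s) = m * (q * s - (- y)) + h\<^sup>2 * s\<^sup>2"
        unfolding shift q(1) y by (simp add: mh algebra_simps)
      moreover have "int l * m dvd h\<^sup>2 * s\<^sup>2" using hh by simp
      ultimately have "int l * m dvd f (a + h * s) \<longleftrightarrow> m * int l dvd m * (q * s - (- y))"
        by (simp only: dvd_add_left_iff mult.commute)
      then show ?thesis using m0 by simp
    qed
    then show ?thesis using sum_linear_congruence[OF l0 q(2), of "- y"] by simp
  qed
  have per: "periodic (int l * m) (\<lambda>a. of_bool (int l * m dvd f a) :: real)"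
    unfolding f_def by (rule periodic_quadratic) simp
  have "real l * root_count t u m = (\<Sum>a\<in>{0..<int l * m}. of_bool (m dvd f a))"
    using root_count_multiple[OF m0, of "int l" t u] by (simp add: f_def)
  also have "\<dots> = (\<Sum>a\<in>{0..<int l * m}. \<Sum>s\<in>{0..<int l}. of_bool (int l * m dvd f (a + h * s)))"
  proof (rule sum.cong)
    fix a
    show "of_bool (m dvd f a) = (\<Sum>s\<in>{0..<int l}. of_bool (int l * m dvd f (a + h * s)) :: real)"
    proof (cases "m dvd f a")
      case True
      then show ?thesis using unique by simp
    next
      case False
      then have "\<not> int l * m dvd f (a + h * s)" for s using descend by blast
      then show ?thesis using False by simp
    qed
  qed simp
  also have "\<dots> = (\<Sum>s\<in>{0..<int l}. \<Sum>a\<in>{0..<int l * m}. of_bool (int l * m dvd f (a + h * s)))"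
    by (rule sum.swap)
  also have "\<dots> = (\<Sum>s\<in>{0..<int l}. root_count t u (int l * m))"
    using sum_periodic_shift[OF _ per] l0 m0 by (simp add: root_count_def) (simp add: f_def)
  also have "\<dots> = real l * root_count t u (int l * m)" by simp
  finally show ?thesis using l0 by (simp add: m_def)
qed

lemma root_count_stable_le:
  assumes l: "prime (l::nat)" and nd: "\<not> int l ^ k dvd t\<^sup>2 - 4 * u" and "k \<le> j"
  shows "root_count t u (int l ^ j) = root_count t u (int l ^ k)"
  using \<open>k \<le> j\<close>
proof (induction j rule: dec_induct)
  case (step j)
  have "\<not> int l ^ j dvd t\<^sup>2 - 4 * u"
    using nd step.hyps by (meson dvd_trans le_imp_power_dvd)
  then show ?case using root_count_stable[OF l] step.IH by metis
qed simp

text \<open>For \<open>l = 2\<close> the trace is odd, so \<open>a\<^sup>2 - t * a\<close> is always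
  even and the parity of \<open>u\<close> decides between two roots and none; it also decides
  whether the discriminant is 1 or 5 modulo 8. For odd \<open>l\<close>, completing the square
  reduces to square roots of the discriminant.\<close>

lemma kronecker_root_count:
  fixes t u :: int
  assumes l: "prime (l::nat)" and nd: "\<not> int l dvd t\<^sup>2 - 4 * u"
  shows "root_count t u (int l) = 1 + of_int (kronecker (t\<^sup>2 - 4 * u) l)"
proof (cases "l = 2")
  case True
  have todd: "odd t" using nd by (auto simp: True)
  then obtain s where s: "t = 2 * s + 1" by (elim oddE)
  have r: "root_count t u 2 = 2 * of_bool (even u)"
  proof -
    have "{0..<2::int} = {0, 1}" by auto
    then show ?thesis using todd by (simp add: root_count_def)
  qed
  have "t\<^sup>2 - 4 * u = 4 * (s * (s + 1)) + 1 - 4 * u"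
    by (simp add: s power2_eq_square algebra_simps)
  moreover obtain p where "s * (s + 1) = 2 * p"
    by (metis evenE even_mult_iff even_plus_one_iff)
  ultimately have D: "t\<^sup>2 - 4 * u = 8 * p + 1 - 4 * u" by simp
  show ?thesis
  proof (cases "even u")
    case True
    then obtain q where "u = 2 * q" by blast
    then have "t\<^sup>2 - 4 * u = 1 + 8 * (p - q)" using D by simp
    then have "(t\<^sup>2 - 4 * u) mod 8 = 1" by (metis mod_mult_self2 mod_pos_pos_trivial zero_le_one one_less_numeral_iff semiring_norm(76))
    moreover have "odd (t\<^sup>2 - 4 * u)" using todd by simp
    ultimately show ?thesis using True \<open>l = 2\<close> r by (simp add: kronecker_def)
  next
    case False
    then obtain q where "u = 2 * q + 1" by (elim oddE)
    then have "t\<^sup>2 - 4 * u = 5 + 8 * (p - q - 1)" using D by simp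
    then have "(t\<^sup>2 - 4 * u) mod 8 = 5 mod 8" by (metis mod_mult_self2)
    moreover have "odd (t\<^sup>2 - 4 * u)" using todd by simp
    ultimately show ?thesis using False \<open>l = 2\<close> r by (simp add: kronecker_def)
  qed
next
  case False
  define L where "L = int l"
  define D where "D = t\<^sup>2 - 4 * u"
  \<comment> \<open>The summand \<open>0 * x\<close> makes this the quadratic of trace 0 and
    constant term \<open>- D\<close>, so that the lemmas on quadratics apply.\<close>
  define g where "g = (\<lambda>x. of_bool (L dvd x\<^sup>2 - 0 * x + (- D)) :: real)"
  have pl: "prime L" using l by (simp add: L_def)
  have L0: "L > 0" using l prime_gt_0_nat by (simp add: L_def)
  have oddL: "odd L" using False l prime_odd_nat[of l] prime_ge_2_nat[OF l] by (auto simp: L_def)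
  have cop2: "coprime 2 L" using oddL by simp
  have "coprime L (2 ^ 2)" using oddL by (simp only: coprime_power_right_iff coprime_right_2_iff_odd) simp
  then have cop4: "coprime L 4" by simp
  have per: "periodic L g" unfolding g_def by (rule periodic_quadratic) simp
  have per': "periodic L (\<lambda>x. g (x + (- t)))"
    by (rule periodicI, rule periodicD[OF per]) (intro cong_add cong_refl)
  have g_iff: "L dvd x\<^sup>2 - t * x + u \<longleftrightarrow> L dvd (2 * x + (- t))\<^sup>2 - 0 * (2 * x + (- t)) + (- D)" for x
  proof -
    have "(2 * x + (- t))\<^sup>2 - 0 * (2 * x + (- t)) + (- D) = 4 * (x\<^sup>2 - t * x + u)"
      by (simp add: D_def power2_eq_square algebra_simps)
    then show ?thesis using cop4 by (simp only: coprime_dvd_mult_right_iff)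
  qed
  have "root_count t u L = (\<Sum>x\<in>{0..<L}. g (2 * x + (- t)))"
    unfolding root_count_def g_def g_iff ..
  also have "\<dots> = (\<Sum>x\<in>{0..<L}. g (x + (- t)))"
    by (rule sum_periodic_scale[OF L0 per' cop2])
  also have "\<dots> = (\<Sum>x\<in>{0..<L}. g x)"
    by (rule sum_periodic_shift[OF L0 per])
  also have "\<dots> = 1 + of_int (Legendre D L)"
  proof (cases "QuadRes L D")
    case True
    then obtain y where y: "[y\<^sup>2 = D] (mod L)" by (auto simp: QuadRes_def)
    \<comment> \<open>The square roots \<open>y\<close> and \<open>- y\<close> are distinct because
      \<open>l\<close> is odd and does not divide \<open>D\<close>; this makes the count 2.\<close>
    have ny: "\<not> L dvd y - (- y)"
    proof
      assume "L dvd y - (- y)"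
      then have "L dvd 2 * y" by simp
      then have "L dvd y" using cop2 by (metis coprime_dvd_mult_right_iff coprime_commute)
      then have "L dvd y\<^sup>2" by (simp add: power2_eq_square)
      then have "L dvd D" using y cong_dvd_iff by blast
      then show False using nd by (simp add: D_def L_def)
    qed
    have "g x = of_bool (L dvd x - y) + of_bool (L dvd x - (- y))" for x
    proof -
      have "L dvd x\<^sup>2 - 0 * x + (- D) \<longleftrightarrow> L dvd x\<^sup>2 - 0 * x + (- (y\<^sup>2))"
        by (intro cong_dvd_iff cong_add cong_refl) (use y in \<open>simp add: cong_sym cong_minus_minus_iff\<close>)
      also have "x\<^sup>2 - 0 * x + (- (y\<^sup>2)) = (x - y) * (x - (- y))"
        by (simp add: power2_eq_square algebra_simps)
      also have "L dvd \<dots> \<longleftrightarrow> L dvd x - y \<or> L dvd x - (- y)"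
        by (rule prime_dvd_mult_iff[OF pl])
      finally have "L dvd x\<^sup>2 - 0 * x + (- D) \<longleftrightarrow> L dvd x - y \<or> L dvd x - (- y)" .
      moreover have "\<not> (L dvd x - y \<and> L dvd x - (- y))"
      proof
        assume "L dvd x - y \<and> L dvd x - (- y)"
        then have "L dvd (x - (- y)) - (x - y)" using dvd_diff by blast
        moreover have "(x - (- y)) - (x - y) = y - (- y)" by simp
        ultimately show False using ny by metis
      qed
      ultimately show ?thesis unfolding g_def
        by (cases "L dvd x - y"; cases "L dvd x - (- y)") (simp_all only: of_bool_eq simp_thms add_0_left add_0_right)
    qed
    then have "(\<Sum>x\<in>{0..<L}. g x) = 2"
      by (simp only: sum.distrib sum_residue_class_count[OF L0])
    moreover have "Legendre D L = 1"
      using True nd by (auto simp: Legendre_def D_def L_def cong_0_iff)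
    ultimately show ?thesis by simp
  next
    case False
    have "g x = 0" for x
    proof -
      have "\<not> [x\<^sup>2 = D] (mod L)" using False by (auto simp: QuadRes_def)
      then show ?thesis by (simp add: g_def cong_iff_dvd_diff)
    qed
    moreover have "Legendre D L = - 1"
      using False nd by (auto simp: Legendre_def D_def L_def cong_0_iff)
    ultimately show ?thesis by simp
  qed
  finally show ?thesis using False by (simp add: kronecker_def D_def L_def)
qed

section \<open>Counting matrices by trace and determinant\<close>

definition hyperbola_count :: "int \<Rightarrow> int \<Rightarrow> real" where
  "hyperbola_count m x = (\<Sum>b\<in>{0..<m}. \<Sum>c\<in>{0..<m}. of_bool (m dvd b * c - x))"

text \<open>A unit \<open>b\<close> admits exactly one \<open>c\<close>, and there are
  \<open>l ^ Suc r - l ^ r\<close> units. If \<open>l\<close> divides \<open>b\<close>, it must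
  divide \<open>x\<close>; cancelling it leaves a congruence modulo \<open>l ^ r\<close>, in which
  \<open>c\<close> is counted \<open>l\<close> times.\<close>

lemma hyperbola_count_Suc:
  assumes l: "prime (l::nat)"
  shows "hyperbola_count (int l ^ Suc r) x =
    real l ^ Suc r - real l ^ r + of_bool (int l dvd x) * real l * hyperbola_count (int l ^ r) (x div int l)"
proof -
  define M where "M = int l ^ r"
  define g where "g = (\<lambda>b. \<Sum>c\<in>{0..<int l * M}. of_bool (int l * M dvd b * c - x) :: real)"
  have l0: "int l > 0" using l prime_gt_0_nat by simp
  have pl: "prime (int l)" using l by simp
  have M0: "M > 0" using l0 by (simp add: M_def)
  have unit: "g b = 1" if "\<not> int l dvd b" for b
  proof -
    have "coprime b (int l * M)"
      using prime_imp_coprime[OF pl that] by (simp add: M_def coprime_commute)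
    then show ?thesis unfolding g_def using l0 M0 by (intro sum_linear_congruence) auto
  qed
  have mult: "g (int l * b) = of_bool (int l dvd x) * real l * (\<Sum>c\<in>{0..<M}. of_bool (M dvd b * c - x div int l))" for b
  proof (cases "int l dvd x")
    case True
    then obtain y where y: "x = int l * y" by blast
    have "int l * M dvd int l * b * c - x \<longleftrightarrow> M dvd b * c - y" for c
    proof -
      have "int l * b * c - x = int l * (b * c - y)" by (simp add: y algebra_simps)
      then show ?thesis using l0 by simp
    qed
    then have "g (int l * b) = (\<Sum>c\<in>{0..<int l * M}. of_bool (M dvd b * c - y))"
      by (simp add: g_def)
    also have "\<dots> = real_of_int (int l) * (\<Sum>c\<in>{0..<M}. of_bool (M dvd b * c - y))"
    proof (rule sum_periodic_multiple)
      show "periodic M (\<lambda>c. of_bool (M dvd b * c - y) :: real)"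
        by (intro periodicI arg_cong[where f = of_bool] cong_dvd_iff cong_diff cong_mult cong_refl)
    qed (use M0 in auto)
    finally show ?thesis using True y l0 by simp
  next
    case False
    have "\<not> int l * M dvd int l * b * c - x" for c
    proof
      assume "int l * M dvd int l * b * c - x"
      then have "int l dvd int l * b * c - x" by (rule dvd_mult_left)
      moreover have "int l dvd int l * b * c" by simp
      ultimately have "int l dvd int l * b * c - (int l * b * c - x)" by (rule dvd_diff[rotated])
      then show False using False by simp
    qed
    then show ?thesis using False by (simp add: g_def)
  qed
  have "hyperbola_count (int l * M) x = (\<Sum>b\<in>{0..<int l * M}. g b)"
    by (simp add: hyperbola_count_def g_def)
  also have "\<dots> = (\<Sum>b\<in>{0..<int l * M}. (1 - of_bool (int l dvd b) * 1) + of_bool (int l dvd b) * g b)"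
    by (intro sum.cong refl) (auto simp: unit)
  also have "\<dots> = (real l * real_of_int M - real_of_int M) + (\<Sum>b\<in>{0..<M}. g (int l * b))"
    unfolding sum.distrib sum_subtractf sum_multiples[OF l0]
    using l0 M0 by simp
  also have "(\<Sum>b\<in>{0..<M}. g (int l * b)) = of_bool (int l dvd x) * real l * hyperbola_count M (x div int l)"
    by (simp add: mult hyperbola_count_def sum_distrib_left)
  finally show ?thesis by (simp add: M_def)
qed

text \<open>Unrolls the recursion. Indicators are used instead of the valuation of \<open>x\<close>:
  they cover \<open>x = 0\<close>, and summing them over \<open>a\<close> later gives root counts
  directly.\<close>

lemma hyperbola_count_prime_power:
  assumes l: "prime (l::nat)"
  shows "hyperbola_count (int l ^ r) x =
    real l ^ r * ((1 - 1 / real l) * (\<Sum>i<r. of_bool (int l ^ i dvd x)) + of_bool (int l ^ r dvd x))"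
proof (induction r arbitrary: x)
  case 0
  then show ?case by (simp add: hyperbola_count_def atLeastLessThan_singleton)
next
  case (Suc r)
  have l0: "real l > 0" using l prime_gt_0_nat by simp
  show ?case
  proof (cases "int l dvd x")
    case True
    then obtain y where y: "x = int l * y" by blast
    have "int l ^ Suc i dvd x \<longleftrightarrow> int l ^ i dvd y" for i
      using l0 by (simp add: y)
    then show ?thesis
      using l0 unfolding hyperbola_count_Suc[OF l] sum.lessThan_Suc_shift
      by (simp add: Suc.IH True y field_simps)
  next
    case False
    then have "\<not> int l ^ Suc i dvd x" for i
      by (metis dvd_mult_left power_Suc)
    then show ?thesis
      using l0 False unfolding hyperbola_count_Suc[OF l] sum.lessThan_Suc_shift
      by (simp add: field_simps del: power_Suc) (simp add: field_simps)
  qed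
qed

text \<open>The triple \<open>(a, b, c)\<close> stands for the matrix with rows \<open>(a, b)\<close> and \<open>(c, t - a)\<close>, of trace
  \<open>t\<close>, which is required to vanish modulo \<open>k\<close> and to have determinant \<open>u\<close> modulo \<open>m\<close>.\<close>

definition mat_ok :: "int \<Rightarrow> int \<Rightarrow> int \<Rightarrow> int \<Rightarrow> int \<Rightarrow> int \<Rightarrow> int \<Rightarrow> bool" where
  "mat_ok t u k m a b c \<longleftrightarrow>
     k dvd a \<and> k dvd t - a \<and> k dvd b \<and> k dvd c \<and> m dvd a * (t - a) - b * c - u"

definition mat_count :: "int \<Rightarrow> int \<Rightarrow> int \<Rightarrow> int \<Rightarrow> real" where
  "mat_count t u k m = (\<Sum>a\<in>{0..<m}. \<Sum>b\<in>{0..<m}. \<Sum>c\<in>{0..<m}. of_bool (mat_ok t u k m a b c))"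

lemma mat_ok_cong:
  assumes "k dvd m" "[a = a'] (mod m)" "[b = b'] (mod m)" "[c = c'] (mod m)"
  shows "mat_ok t u k m a b c \<longleftrightarrow> mat_ok t u k m a' b' c'"
proof -
  have *: "[a = a'] (mod k)" "[b = b'] (mod k)" "[c = c'] (mod k)"
    using assms cong_dvd_modulus by blast+
  have "[t - a = t - a'] (mod k)" by (intro cong_diff cong_refl *)
  moreover have "[a * (t - a) - b * c - u = a' * (t - a') - b' * c' - u] (mod m)"
    by (intro cong_diff cong_mult cong_refl assms)
  ultimately show ?thesis
    unfolding mat_ok_def using * by (simp add: cong_dvd_iff)
qed

section \<open>Rescaling of matrix counts\<close>

lemma periodic_sum:
  fixes F :: "int \<Rightarrow> 'b \<Rightarrow> real"
  assumes "\<And>y. periodic m (\<lambda>x. F x y)"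
  shows "periodic m (\<lambda>x. \<Sum>y\<in>A. F x y)"
  using assms by (intro periodicI sum.cong refl) (metis periodicD)

lemma triple_sum_multiple:
  fixes F :: "int \<Rightarrow> int \<Rightarrow> int \<Rightarrow> real"
  assumes "m > 0" "k \<ge> 0"
    and "\<And>b c. periodic m (\<lambda>a. F a b c)" "\<And>a c. periodic m (\<lambda>b. F a b c)"
      "\<And>a b. periodic m (\<lambda>c. F a b c)"
  shows "(\<Sum>a\<in>{0..<k * m}. \<Sum>b\<in>{0..<k * m}. \<Sum>c\<in>{0..<k * m}. F a b c) =
    of_int k ^ 3 * (\<Sum>a\<in>{0..<m}. \<Sum>b\<in>{0..<m}. \<Sum>c\<in>{0..<m}. F a b c)"
proof -
  have c: "(\<Sum>c\<in>{0..<k * m}. F a b c) = of_int k * (\<Sum>c\<in>{0..<m}. F a b c)" for a b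
    by (rule sum_periodic_multiple[OF assms(1,2,5)])
  have b: "(\<Sum>b\<in>{0..<k * m}. \<Sum>c\<in>{0..<m}. F a b c) = of_int k * (\<Sum>b\<in>{0..<m}. \<Sum>c\<in>{0..<m}. F a b c)" for a
    by (rule sum_periodic_multiple[OF assms(1,2) periodic_sum[OF assms(4)]])
  have a: "(\<Sum>a\<in>{0..<k * m}. \<Sum>b\<in>{0..<m}. \<Sum>c\<in>{0..<m}. F a b c)
      = of_int k * (\<Sum>a\<in>{0..<m}. \<Sum>b\<in>{0..<m}. \<Sum>c\<in>{0..<m}. F a b c)"
    by (rule sum_periodic_multiple[OF assms(1,2) periodic_sum[OF periodic_sum[OF assms(3)]]])
  show ?thesis
    unfolding c sum_distrib_left[symmetric] b a by (simp add: power3_eq_cube)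
qed

lemma triple_sum_scale:
  fixes F :: "int \<Rightarrow> int \<Rightarrow> int \<Rightarrow> real"
  assumes "m > 0" "coprime k m"
    and "\<And>b c. periodic m (\<lambda>a. F a b c)" "\<And>a c. periodic m (\<lambda>b. F a b c)"
      "\<And>a b. periodic m (\<lambda>c. F a b c)"
  shows "(\<Sum>a\<in>{0..<m}. \<Sum>b\<in>{0..<m}. \<Sum>c\<in>{0..<m}. F (k * a) (k * b) (k * c)) =
    (\<Sum>a\<in>{0..<m}. \<Sum>b\<in>{0..<m}. \<Sum>c\<in>{0..<m}. F a b c)"
proof -
  have c: "(\<Sum>c\<in>{0..<m}. F a b (k * c)) = (\<Sum>c\<in>{0..<m}. F a b c)" for a b
    by (rule sum_periodic_scale[OF assms(1) assms(5) assms(2)])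
  have b: "(\<Sum>b\<in>{0..<m}. \<Sum>c\<in>{0..<m}. F a (k * b) c) = (\<Sum>b\<in>{0..<m}. \<Sum>c\<in>{0..<m}. F a b c)" for a
    by (rule sum_periodic_scale[OF assms(1) periodic_sum[OF assms(4)] assms(2)])
  show ?thesis
    unfolding c b
    by (rule sum_periodic_scale[OF assms(1) periodic_sum[OF periodic_sum[OF assms(3)]] assms(2)])
qed

lemma triple_sum_multiples:
  fixes F :: "int \<Rightarrow> int \<Rightarrow> int \<Rightarrow> real"
  assumes k: "k > 0"
    and "\<And>a b c. F a b c \<noteq> 0 \<Longrightarrow> k dvd a \<and> k dvd b \<and> k dvd c"
  shows "(\<Sum>a\<in>{0..<k * m}. \<Sum>b\<in>{0..<k * m}. \<Sum>c\<in>{0..<k * m}. F a b c) =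
    (\<Sum>a\<in>{0..<m}. \<Sum>b\<in>{0..<m}. \<Sum>c\<in>{0..<m}. F (k * a) (k * b) (k * c))"
proof -
  have *: "F a b c = of_bool (k dvd a) * (of_bool (k dvd b) * (of_bool (k dvd c) * F a b c))" for a b c
    using assms(2)[of a b c] by (cases "F a b c = 0") auto
  have "(\<Sum>a\<in>{0..<k * m}. \<Sum>b\<in>{0..<k * m}. \<Sum>c\<in>{0..<k * m}. F a b c) =
    (\<Sum>a\<in>{0..<k * m}. \<Sum>b\<in>{0..<k * m}. \<Sum>c\<in>{0..<k * m}.
      of_bool (k dvd a) * (of_bool (k dvd b) * (of_bool (k dvd c) * F a b c)))"
    by (intro sum.cong refl) (rule *)
  then show ?thesis
    by (simp only: sum_distrib_left[symmetric] sum_multiples[OF k])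
qed

lemma periodic_mat_ok:
  assumes "k dvd m"
  shows "periodic m (\<lambda>a. of_bool (mat_ok t u k m a b c) :: real)"
    "periodic m (\<lambda>b. of_bool (mat_ok t u k m a b c) :: real)"
    "periodic m (\<lambda>c. of_bool (mat_ok t u k m a b c) :: real)"
  by (intro periodicI arg_cong[where f = of_bool] mat_ok_cong assms cong_refl; assumption)+

text \<open>All entries counted are multiples of \<open>k\<close>. Dividing by \<open>k\<close>
  lowers the modulus of the determinant condition by \<open>k\<^sup>2\<close> but the range of the
  entries only by \<open>k\<close>, so each of the three entries contributes a surplus factor
  \<open>k\<close>.\<close>

lemma mat_count_scale:
  assumes "m > 0" "k > 0" "w dvd m"
  shows "mat_count (k * t) (k\<^sup>2 * u) (k * w) (k\<^sup>2 * m) = of_int k ^ 3 * mat_count t u w m"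
proof -
  define F where "F = (\<lambda>a b c. of_bool (mat_ok (k * t) (k\<^sup>2 * u) (k * w) (k\<^sup>2 * m) a b c) :: real)"
  have ok: "mat_ok (k * t) (k\<^sup>2 * u) (k * w) (k\<^sup>2 * m) (k * a) (k * b) (k * c) \<longleftrightarrow> mat_ok t u w m a b c"
    for a b c
  proof -
    have "k * a * (k * t - k * a) - k * b * (k * c) - k\<^sup>2 * u = k\<^sup>2 * (a * (t - a) - b * c - u)"
      by (simp add: power2_eq_square algebra_simps)
    moreover have "k * t - k * a = k * (t - a)" by (simp add: algebra_simps)
    ultimately show ?thesis unfolding mat_ok_def using assms(2) by simp
  qed
  have km: "k\<^sup>2 * m = k * (k * m)" by (simp add: power2_eq_square)
  have "mat_count (k * t) (k\<^sup>2 * u) (k * w) (k\<^sup>2 * m) =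
     (\<Sum>a\<in>{0..<k * (k * m)}. \<Sum>b\<in>{0..<k * (k * m)}. \<Sum>c\<in>{0..<k * (k * m)}. F a b c)"
    by (simp add: mat_count_def F_def km)
  also have "\<dots> = (\<Sum>a\<in>{0..<k * m}. \<Sum>b\<in>{0..<k * m}. \<Sum>c\<in>{0..<k * m}. F (k * a) (k * b) (k * c))"
    by (rule triple_sum_multiples[OF assms(2)]) (auto simp: F_def mat_ok_def dest: dvd_mult_left)
  also have "\<dots> = of_int k ^ 3 * mat_count t u w m"
    unfolding F_def ok mat_count_def
    by (rule triple_sum_multiple) (use assms in \<open>auto intro: periodic_mat_ok\<close>)
  finally show ?thesis .
qed

text \<open>Multiplication by a unit permutes the residues and preserves every divisibility
  condition.\<close>

lemma mat_count_unit_scale: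
  assumes "m > 0" "coprime k m" "w dvd m"
  shows "mat_count (k * t) (k\<^sup>2 * u) w m = mat_count t u w m"
proof -
  have cw: "coprime w k" using assms(2,3) by (metis coprime_commute coprime_divisors dvd_refl)
  have cm: "coprime m (k\<^sup>2)" using assms(2) by (simp add: coprime_commute)
  have ok: "mat_ok (k * t) (k\<^sup>2 * u) w m (k * a) (k * b) (k * c) \<longleftrightarrow> mat_ok t u w m a b c" for a b c
  proof -
    have "k * a * (k * t - k * a) - k * b * (k * c) - k\<^sup>2 * u = k\<^sup>2 * (a * (t - a) - b * c - u)"
      by (simp add: power2_eq_square algebra_simps)
    moreover have "k * t - k * a = k * (t - a)" by (simp add: algebra_simps)
    ultimately show ?thesis unfolding mat_ok_def
      by (simp only: coprime_dvd_mult_right_iff[OF cw] coprime_dvd_mult_right_iff[OF cm])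
  qed
  show ?thesis
    unfolding mat_count_def
    by (subst triple_sum_scale[OF assms(1,2), symmetric])
      (use assms(3) in \<open>auto intro: periodic_mat_ok simp: ok\<close>)
qed

text \<open>For fixed \<open>a\<close> the pairs \<open>(b, c)\<close> form a hyperbola; the
  indicators in its count are then summed over \<open>a\<close>.\<close>

lemma mat_count_prime_power:
  assumes l: "prime (l::nat)"
  shows "mat_count t u 1 (int l ^ r) = real l ^ (2 * r) *
    ((1 - 1 / real l) * (\<Sum>i<r. root_count t u (int l ^ i) / real l ^ i) + root_count t u (int l ^ r) / real l ^ r)"
proof -
  define M where "M = int l ^ r"
  define x where "x = (\<lambda>a. a * (t - a) - u)"
  have l0: "int l > 0" using l prime_gt_0_nat by simp
  have ok: "mat_ok t u 1 M a b c \<longleftrightarrow> M dvd b * c - x a" for a b c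
    unfolding mat_ok_def x_def by (subst dvd_minus_iff[symmetric]) (simp add: algebra_simps)
  have x_dvd: "int l ^ i dvd x a \<longleftrightarrow> int l ^ i dvd a\<^sup>2 - t * a + u" for i a
    unfolding x_def by (subst dvd_minus_iff[symmetric]) (simp add: power2_eq_square algebra_simps)
  \<comment> \<open>Each root modulo \<open>l ^ i\<close> has \<open>l ^ (r - i)\<close> lifts
    modulo \<open>l ^ r\<close>.\<close>
  have roots: "(\<Sum>a\<in>{0..<M}. of_bool (int l ^ i dvd x a)) = real l ^ r * (root_count t u (int l ^ i) / real l ^ i)"
    if "i \<le> r" for i
  proof -
    have M: "M = int l ^ (r - i) * int l ^ i" using that by (simp add: M_def flip: power_add)
    have "real l ^ r = real l ^ (r - i) * real l ^ i" using that by (simp flip: power_add)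
    then show ?thesis
      unfolding x_dvd M using l0 by (subst root_count_multiple) auto
  qed
  have "mat_count t u 1 M = (\<Sum>a\<in>{0..<M}. hyperbola_count M (x a))"
    by (simp add: mat_count_def hyperbola_count_def ok)
  also have "\<dots> = real l ^ r * ((1 - 1 / real l) * (\<Sum>a\<in>{0..<M}. \<Sum>i<r. of_bool (int l ^ i dvd x a))
      + (\<Sum>a\<in>{0..<M}. of_bool (int l ^ r dvd x a)))"
    unfolding M_def hyperbola_count_prime_power[OF l]
    by (simp add: sum.distrib flip: sum_distrib_left)
  also have "(\<Sum>a\<in>{0..<M}. \<Sum>i<r. of_bool (int l ^ i dvd x a))
      = real l ^ r * (\<Sum>i<r. root_count t u (int l ^ i) / real l ^ i)"
    unfolding sum_distrib_left by (subst sum.swap) (intro sum.cong refl roots, simp)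
  also have "(\<Sum>a\<in>{0..<M}. of_bool (int l ^ r dvd x a)) = real l ^ r * (root_count t u (int l ^ r) / real l ^ r)"
    by (rule roots) simp
  finally show ?thesis
    unfolding M_def mult_2 power_add by (simp only: distrib_left mult_ac)
qed

section \<open>Passage from sets of matrices to iterated sums\<close>

lemma card_mat2_mod:
  "real (card {A \<in> mat2_mod m. P (A $ 1 $ 1) (A $ 1 $ 2) (A $ 2 $ 1) (A $ 2 $ 2)}) =
    (\<Sum>a\<in>{0..<int m}. \<Sum>b\<in>{0..<int m}. \<Sum>c\<in>{0..<int m}. \<Sum>d\<in>{0..<int m}. of_bool (P a b c d))"
proof -
  define I where "I = {0..<int m}"
  define S where "S = I \<times> I \<times> I \<times> I"
  have "bij_betw (\<lambda>A. (A $ 1 $ 1, A $ 1 $ 2, A $ 2 $ 1, A $ 2 $ 2))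
      {A \<in> mat2_mod m. P (A $ 1 $ 1) (A $ 1 $ 2) (A $ 2 $ 1) (A $ 2 $ 2)}
      {x \<in> S. case x of (a, b, c, d) \<Rightarrow> P a b c d}"
    by (rule bij_betw_byWitness[where f' = "\<lambda>(a, b, c, d). vector [vector [a, b], vector [c, d]]"])
      (auto simp: S_def I_def mat2_mod_def vec_eq_iff forall_2 vector_2)
  then have "card {A \<in> mat2_mod m. P (A $ 1 $ 1) (A $ 1 $ 2) (A $ 2 $ 1) (A $ 2 $ 2)} =
      card {x \<in> S. case x of (a, b, c, d) \<Rightarrow> P a b c d}"
    by (rule bij_betw_same_card)
  moreover have "finite S" by (simp add: S_def I_def)
  then have "real (card {x \<in> S. case x of (a, b, c, d) \<Rightarrow> P a b c d}) =
      (\<Sum>x\<in>S. of_bool (case x of (a, b, c, d) \<Rightarrow> P a b c d))"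
    by (simp add: sum_of_bool_eq Int_def)
  moreover have "\<dots> = (\<Sum>(a, b, c, d)\<in>S. of_bool (P a b c d))"
    by (intro sum.cong refl) auto
  ultimately show ?thesis
    by (simp add: S_def I_def sum.cartesian_product)
qed

text \<open>The trace determines the entry \<open>d\<close>, and replacing \<open>a\<close> by
  \<open>a + e\<close> amounts to passing from \<open>A\<close> to \<open>A - mat e\<close>. The new
  trace is \<open>t - 2 * e\<close> and the new determinant is the characteristic polynomial at
  \<open>e\<close>. The case \<open>e = 1\<close> serves \<open>C_set\<close>, the case
  \<open>e = 0\<close> the matrices vanishing modulo \<open>l\<close>.\<close>

lemma card_trace_det:
  assumes "k dvd m" "m > 0"
  shows "real (card {A \<in> mat2_mod m. [trace A = t] (mod int m) \<and> [det A = u] (mod int m) \<and> mat_cong k A (mat e)}) =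
    mat_count (t - 2 * e) (u - e * t + e\<^sup>2) (int k) (int m)"
proof -
  define M where "M = int m"
  define N where "N = int k"
  define Q where "Q = (\<lambda>a b c d. N dvd a - e \<and> N dvd b \<and> N dvd c \<and> N dvd d - e \<and> M dvd a * d - b * c - u)"
  have NM: "N dvd M" using assms by (simp add: M_def N_def)
  have M0: "M > 0" using assms by (simp add: M_def)
  have "{A \<in> mat2_mod m. [trace A = t] (mod M) \<and> [det A = u] (mod M) \<and> mat_cong k A (mat e)} =
     {A \<in> mat2_mod m. M dvd A $ 2 $ 2 - (t - A $ 1 $ 1) \<and> Q (A $ 1 $ 1) (A $ 1 $ 2) (A $ 2 $ 1) (A $ 2 $ 2)}"
    by (auto simp: trace_def sum_2 det_2 mat_cong_def forall_2 mat_def cong_iff_dvd_diff Q_def N_def algebra_simps)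
  then have "real (card {A \<in> mat2_mod m. [trace A = t] (mod M) \<and> [det A = u] (mod M) \<and> mat_cong k A (mat e)}) =
    (\<Sum>a\<in>{0..<M}. \<Sum>b\<in>{0..<M}. \<Sum>c\<in>{0..<M}. \<Sum>d\<in>{0..<M}. of_bool (M dvd d - (t - a) \<and> Q a b c d))"
    using card_mat2_mod[of m "\<lambda>a b c d. M dvd d - (t - a) \<and> Q a b c d"] by (simp add: M_def)
  also have "\<dots> = (\<Sum>a\<in>{0..<M}. \<Sum>b\<in>{0..<M}. \<Sum>c\<in>{0..<M}. of_bool (Q a b c (t - a)))"
  proof -
    have "(\<Sum>d\<in>{0..<M}. of_bool (M dvd d - (t - a) \<and> Q a b c d)) = (of_bool (Q a b c (t - a)) :: real)" for a b c
    proof -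
      have "periodic M (\<lambda>d. of_bool (Q a b c d) :: real)"
      proof (intro periodicI arg_cong[where f = of_bool])
        fix x y assume xy: "[x = y] (mod M)"
        then have "[x = y] (mod N)" using NM cong_dvd_modulus by blast
        then have "[x - e = y - e] (mod N)" by (intro cong_diff cong_refl)
        moreover have "[a * x - b * c - u = a * y - b * c - u] (mod M)"
          by (intro cong_diff cong_mult cong_refl xy)
        ultimately show "Q a b c x = Q a b c y" unfolding Q_def by (simp add: cong_dvd_iff)
      qed
      from sum_residue_class[OF M0 this, of "t - a"] show ?thesis by (simp add: of_bool_conj)
    qed
    then show ?thesis by simp
  qed
  also have "\<dots> = (\<Sum>a\<in>{0..<M}. \<Sum>b\<in>{0..<M}. \<Sum>c\<in>{0..<M}. of_bool (Q (a + e) b c (t - (a + e))))"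
  proof (rule sum_periodic_shift[symmetric, OF M0], intro periodic_sum)
    show "periodic M (\<lambda>a. of_bool (Q a b c (t - a)) :: real)" for b c
    proof (intro periodicI arg_cong[where f = of_bool])
      fix x y assume xy: "[x = y] (mod M)"
      then have xyN: "[x = y] (mod N)" using NM cong_dvd_modulus by blast
      then have "[x - e = y - e] (mod N)" "[t - x - e = t - y - e] (mod N)"
        by (intro cong_diff cong_refl; assumption)+
      moreover have "[x * (t - x) - b * c - u = y * (t - y) - b * c - u] (mod M)"
        by (intro cong_diff cong_mult cong_refl xy)
      ultimately show "Q x b c (t - x) = Q y b c (t - y)" unfolding Q_def by (simp add: cong_dvd_iff)
    qed
  qed
  also have "\<dots> = mat_count (t - 2 * e) (u - e * t + e\<^sup>2) N M"
    unfolding mat_count_def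
  proof (intro sum.cong refl arg_cong[where f = of_bool])
    fix a b c
    have "(a + e) * (t - (a + e)) - b * c - u = a * (t - 2 * e - a) - b * c - (u - e * t + e\<^sup>2)"
      by (simp add: power2_eq_square algebra_simps)
    moreover have "t - (a + e) - e = t - 2 * e - a" "a + e - e = a" by simp_all
    ultimately show "Q (a + e) b c (t - (a + e)) = mat_ok (t - 2 * e) (u - e * t + e\<^sup>2) N M a b c"
      unfolding Q_def mat_ok_def by (simp only: conj_ac)
  qed
  finally show ?thesis by (simp add: M_def N_def)
qed

lemma card_C_set:
  assumes "l > 0" "multiplicity l n \<le> r"
  shows "real (card (C_set t u n l r)) = mat_count (t - 2) (u + 1 - t) (int l ^ multiplicity l n) (int l ^ r)"
  using card_trace_det[of "l ^ multiplicity l n" "l ^ r" t u 1] assms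
  by (simp add: C_set_def le_imp_power_dvd min_absorb2 algebra_simps)

lemma card_C_set_1:
  assumes "l > 0"
  shows "real (card (C_set t u 1 l r)) = mat_count t u 1 (int l ^ r)"
proof -
  \<comment> \<open>Congruence modulo 1 is vacuous, so the zero matrix may be the target; this
    choice leaves \<open>t\<close> and \<open>u\<close> unshifted.\<close>
  have "C_set t u 1 l r = {A \<in> mat2_mod (l ^ r). [trace A = t] (mod int (l ^ r)) \<and> [det A = u] (mod int (l ^ r)) \<and> mat_cong 1 A (mat 0)}"
    by (simp add: C_set_def mat_cong_def)
  then show ?thesis using card_trace_det[of 1 "l ^ r" t u 0] assms by simp
qed

lemma finite_mat2_mod: "finite (mat2_mod m)"
proof (rule finite_subset)
  show "mat2_mod m \<subseteq> (\<lambda>(a, b, c, d). vector [vector [a, b], vector [c, d]]) `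
      ({0..<int m} \<times> {0..<int m} \<times> {0..<int m} \<times> {0..<int m})"
  proof
    fix A assume "A \<in> mat2_mod m"
    then show "A \<in> (\<lambda>(a, b, c, d). vector [vector [a, b], vector [c, d]]) `
      ({0..<int m} \<times> {0..<int m} \<times> {0..<int m} \<times> {0..<int m})"
      by (intro image_eqI[where x = "(A $ 1 $ 1, A $ 1 $ 2, A $ 2 $ 1, A $ 2 $ 2)"])
        (auto simp: mat2_mod_def vec_eq_iff forall_2 vector_2)
  qed
qed auto

lemma card_C_set_nonzero:
  assumes "l > 0" "r \<ge> 1"
  shows "real (card {A \<in> C_set t u 1 l r. \<not> mat_cong l A (mat 0)}) =
    mat_count t u 1 (int l ^ r) - mat_count t u (int l) (int l ^ r)"
proof -
  have fin: "finite (C_set t u 1 l r)"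
    unfolding C_set_def using finite_mat2_mod by simp
  have "{A \<in> C_set t u 1 l r. mat_cong l A (mat 0)} = {A \<in> mat2_mod (l ^ r). [trace A = t] (mod int (l ^ r)) \<and> [det A = u] (mod int (l ^ r)) \<and> mat_cong l A (mat 0)}"
    by (auto simp: C_set_def mat_cong_def)
  then have 1: "real (card {A \<in> C_set t u 1 l r. mat_cong l A (mat 0)}) = mat_count t u (int l) (int l ^ r)"
    using card_trace_det[of l "l ^ r" t u 0] assms by (simp add: dvd_power)
  have "card (C_set t u 1 l r) =
      card ({A \<in> C_set t u 1 l r. \<not> mat_cong l A (mat 0)} \<union> {A \<in> C_set t u 1 l r. mat_cong l A (mat 0)})"
    by (rule arg_cong[where f = card]) auto
  also have "\<dots> = card {A \<in> C_set t u 1 l r. \<not> mat_cong l A (mat 0)} + card {A \<in> C_set t u 1 l r. mat_cong l A (mat 0)}"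
    using fin by (intro card_Un_disjoint) auto
  finally show ?thesis using 1 card_C_set_1[OF assms(1), of t u r] by linarith
qed

section \<open>The order of the general linear group modulo prime powers\<close>

lemma GL2_mod_iff:
  assumes "prime l" "r \<ge> 1" "A \<in> mat2_mod (l ^ r)"
  shows "A \<in> GL2_mod (l ^ r) \<longleftrightarrow> \<not> int l dvd A $ 1 $ 1 * A $ 2 $ 2 - A $ 1 $ 2 * A $ 2 $ 1"
proof -
  define M where "M = int (l ^ r)"
  define \<Delta> where "\<Delta> = A $ 1 $ 1 * A $ 2 $ 2 - A $ 1 $ 2 * A $ 2 $ 1"
  have pl: "prime (int l)" using assms by simp
  have M0: "M > 0" using assms prime_gt_0_nat by (simp add: M_def)
  have lM: "int l dvd M" using assms by (simp add: M_def dvd_power)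
  show ?thesis unfolding \<Delta>_def[symmetric]
  proof
    assume "A \<in> GL2_mod (l ^ r)"
    then obtain B where "mat_cong (l ^ r) (A ** B) (mat 1)" by (auto simp: GL2_mod_def)
    then have e: "[(A ** B) $ i $ j = mat 1 $ i $ j] (mod M)" for i j
      by (simp add: mat_cong_def M_def)
    have "[det (A ** B) = 1 * 1 - 0 * 0] (mod M)"
      unfolding det_2 using e[of 1 1] e[of 1 2] e[of 2 1] e[of 2 2]
      by (intro cong_diff cong_mult) (simp_all add: mat_def)
    then have "[\<Delta> * det B = 1] (mod M)"
      unfolding det_mul by (simp add: det_2 \<Delta>_def)
    then have "[\<Delta> * det B = 1] (mod int l)" using lM cong_dvd_modulus by blast
    then show "\<not> int l dvd \<Delta>"
      using pl by (metis cong_dvd_iff dvd_mult2 not_prime_unit)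
  next
    assume "\<not> int l dvd \<Delta>"
    then have "coprime \<Delta> M" using prime_imp_coprime[OF pl] by (simp add: M_def coprime_commute)
    then obtain s where s: "[\<Delta> * s = 1] (mod M)" using cong_solve_coprime_int by blast
    \<comment> \<open>The adjugate times an inverse \<open>s\<close> of the determinant, reduced to
      the residue system.\<close>
    define B :: "int^2^2" where "B = vector [vector [(s * A $ 2 $ 2) mod M, (- s * A $ 1 $ 2) mod M],
      vector [(- s * A $ 2 $ 1) mod M, (s * A $ 1 $ 1) mod M]]"
    have B: "B \<in> mat2_mod (l ^ r)"
      unfolding mat2_mod_def M_def[symmetric] using M0 by (auto simp: B_def forall_2 vector_2)
    have C: "[x * (p mod M) + y * (q mod M) = x * p + y * q] (mod M)" 
      "[(p mod M) * x + (q mod M) * y = p * x + q * y] (mod M)" for x y p q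
      by (intro cong_add cong_mult cong_refl; simp add: cong_def)+
    have "mat_cong (l ^ r) (A ** B) (mat 1) \<and> mat_cong (l ^ r) (B ** A) (mat 1)"
      unfolding mat_cong_def forall_2 matrix_matrix_mult_def M_def[symmetric]
      using s by (auto simp: sum_2 B_def vector_2 mat_def intro!: cong_trans[OF C(1)] cong_trans[OF C(2)])
        (simp_all add: \<Delta>_def algebra_simps)
    then show "A \<in> GL2_mod (l ^ r)" using assms(3) B by (auto simp: GL2_mod_def)
  qed
qed

text \<open>For fixed \<open>b\<close> and \<open>c\<close> the pairs \<open>(a, d)\<close> form the
  hyperbola of \<open>b * c\<close>. Its count depends only on whether \<open>l\<close> divides
  \<open>b * c\<close>, and summing that indicator is the hyperbola count at 0.\<close>

lemma card_singular:
  assumes l: "prime (l::nat)"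
  shows "(\<Sum>a\<in>{0..<int l}. \<Sum>b\<in>{0..<int l}. \<Sum>c\<in>{0..<int l}. \<Sum>d\<in>{0..<int l}. of_bool (int l dvd a * d - b * c))
    = real l ^ 3 + real l ^ 2 - real l"
proof -
  have l0: "real l > 0" using l prime_gt_0_nat by simp
  have h: "hyperbola_count (int l) x = real l - 1 + real l * of_bool (int l dvd x)" for x
  proof -
    have "hyperbola_count (int l) x = real l * ((1 - 1 / real l) + of_bool (int l dvd x))"
      using hyperbola_count_prime_power[OF l, of 1 x] by simp
    moreover have "real l * ((1 - 1 / real l) + z) = real l - 1 + real l * z" for z
      using l0 by (simp add: field_simps)
    ultimately show ?thesis by simp
  qed
  have "(\<Sum>a\<in>{0..<int l}. \<Sum>b\<in>{0..<int l}. \<Sum>c\<in>{0..<int l}. \<Sum>d\<in>{0..<int l}. of_bool (int l dvd a * d - b * c))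
    = (\<Sum>b\<in>{0..<int l}. \<Sum>a\<in>{0..<int l}. \<Sum>c\<in>{0..<int l}. \<Sum>d\<in>{0..<int l}. of_bool (int l dvd a * d - b * c) :: real)"
    by (rule sum.swap)
  also have "\<dots> = (\<Sum>b\<in>{0..<int l}. \<Sum>c\<in>{0..<int l}. hyperbola_count (int l) (b * c))"
    unfolding hyperbola_count_def by (intro sum.cong refl sum.swap)
  also have "\<dots> = real l ^ 2 * (real l - 1) + real l * hyperbola_count (int l) 0"
    unfolding hyperbola_count_def[of _ 0] h
    by (simp add: sum.distrib power2_eq_square flip: sum_distrib_left)
  also have "\<dots> = real l ^ 3 + real l ^ 2 - real l"
    unfolding h by (simp add: power2_eq_square power3_eq_cube algebra_simps)
  finally show ?thesis .
qed

text \<open>Singularity depends on the entries modulo \<open>l\<close> only, so the singular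
  matrices modulo \<open>l\<close> are repeated \<open>l ^ (4 * (r - 1))\<close> times and then
  removed from all matrices.\<close>

lemma card_GL2_mod:
  assumes l: "prime (l::nat)" and "r \<ge> 1"
  shows "real (card (GL2_mod (l ^ r))) = real l ^ (4 * r) * (1 - 1 / real l) * (1 - 1 / (real l)\<^sup>2)"
proof -
  define M where "M = int l ^ r"
  obtain s where s: "r = Suc s" using assms(2) by (cases r) auto
  define q where "q = int l ^ s"
  define F where "F = (\<lambda>a b c d. of_bool (int l dvd a * d - b * c) :: real)"
  have l0: "int l > 0" using l prime_gt_0_nat by simp
  have Mq: "M = q * int l" by (simp add: M_def q_def s)
  have q0: "q > 0" using l0 by (simp add: q_def)
  have per: "periodic (int l) (\<lambda>a. F a b c d)" "periodic (int l) (\<lambda>b. F a b c d)"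
    "periodic (int l) (\<lambda>c. F a b c d)" "periodic (int l) (\<lambda>d. F a b c d)" for a b c d
    unfolding F_def
    by (intro periodicI arg_cong[where f = of_bool] cong_dvd_iff cong_diff cong_mult cong_refl; assumption)+
  have "(\<Sum>a\<in>{0..<M}. \<Sum>b\<in>{0..<M}. \<Sum>c\<in>{0..<M}. \<Sum>d\<in>{0..<M}. F a b c d) =
    (\<Sum>a\<in>{0..<M}. of_int q ^ 3 * (\<Sum>b\<in>{0..<int l}. \<Sum>c\<in>{0..<int l}. \<Sum>d\<in>{0..<int l}. F a b c d))"
    unfolding Mq using l0 q0 per by (intro sum.cong refl triple_sum_multiple) auto
  also have "\<dots> = of_int q ^ 4 *
    (\<Sum>a\<in>{0..<int l}. \<Sum>b\<in>{0..<int l}. \<Sum>c\<in>{0..<int l}. \<Sum>d\<in>{0..<int l}. F a b c d)"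
    unfolding Mq sum_distrib_left[symmetric] using l0 q0 per
    by (subst sum_periodic_multiple) (auto intro!: periodic_sum simp: eval_nat_numeral)
  also have "\<dots> = (real l ^ s) ^ 4 * (real l ^ 3 + real l ^ 2 - real l)"
    unfolding F_def card_singular[OF l] by (simp add: q_def)
  finally have sing: "(\<Sum>a\<in>{0..<M}. \<Sum>b\<in>{0..<M}. \<Sum>c\<in>{0..<M}. \<Sum>d\<in>{0..<M}. F a b c d) =
      (real l ^ s) ^ 4 * (real l ^ 3 + real l ^ 2 - real l)" .
  have "GL2_mod (l ^ r) = {A \<in> mat2_mod (l ^ r). \<not> int l dvd A $ 1 $ 1 * A $ 2 $ 2 - A $ 1 $ 2 * A $ 2 $ 1}"
    using GL2_mod_iff[OF assms] by (auto simp: GL2_mod_def)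
  then have "real (card (GL2_mod (l ^ r))) =
      (\<Sum>a\<in>{0..<M}. \<Sum>b\<in>{0..<M}. \<Sum>c\<in>{0..<M}. \<Sum>d\<in>{0..<M}. of_bool (\<not> int l dvd a * d - b * c))"
    using card_mat2_mod[of "l ^ r" "\<lambda>a b c d. \<not> int l dvd a * d - b * c"] by (simp add: M_def)
  also have "\<dots> = (\<Sum>a\<in>{0..<M}. \<Sum>b\<in>{0..<M}. \<Sum>c\<in>{0..<M}. \<Sum>d\<in>{0..<M}. 1 - F a b c d)"
    by (simp add: F_def of_bool_not_iff)
  also have "\<dots> = real_of_int M ^ 4 - (real l ^ s) ^ 4 * (real l ^ 3 + real l ^ 2 - real l)"
    unfolding sum_subtractf sing using l0 q0 by (simp add: Mq eval_nat_numeral)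
  also have "real_of_int M = real l ^ s * real l" by (simp add: M_def s)
  also have "(real l ^ s * real l) ^ 4 - (real l ^ s) ^ 4 * (real l ^ 3 + real l ^ 2 - real l)
      = (real l ^ s) ^ 4 * (real l ^ 4 * (1 - 1 / real l) * (1 - 1 / (real l)\<^sup>2))"
    using l0 by (simp add: field_simps eval_nat_numeral)
  also have "\<dots> = real l ^ (4 * r) * (1 - 1 / real l) * (1 - 1 / (real l)\<^sup>2)"
  proof -
    have "real l ^ (4 * r) = (real l ^ s) ^ 4 * real l ^ 4"
      by (simp add: s algebra_simps flip: power_mult power_add)
    then show ?thesis by simp
  qed
  finally show ?thesis .
qed

lemma one_minus_inverse_square_pos:
  assumes "prime (l::nat)"
  shows "1 - 1 / (real l)\<^sup>2 > 0"
proof -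
  have "real l > 1" using prime_gt_1_nat[OF assms] by simp
  then have "1 / (real l)\<^sup>2 < 1"
    using one_less_power[of "real l" 2] by (subst divide_less_eq_1_pos) linarith+
  then show ?thesis by linarith
qed

text \<open>The factor \<open>1 - 1 / l\<close> of the totient cancels against the group order. The
  count \<open>x\<close> is left free so that the identity serves both \<open>f_seq\<close> and
  \<open>fstar_seq\<close>.\<close>

lemma local_factor:
  assumes l: "prime (l::nat)" and "r \<ge> 1"
  shows "real (l ^ r) * real (totient (l ^ r)) * x / real (card (GL2_mod (l ^ r))) =
    x / (real l ^ (2 * r) * (1 - 1 / (real l)\<^sup>2))"
proof -
  have l1: "real l > 1" using l prime_gt_1_nat by simp
  have "real (totient (l ^ r)) = real l ^ r * (1 - 1 / real l)"
  proof -
    obtain s where s: "r = Suc s" using assms(2) by (cases r) auto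
    have "totient (l ^ r) = l ^ s * (l - 1)" using totient_prime_power[OF l, of r] assms(2) by (simp add: s)
    then show ?thesis using l1 by (simp add: s of_nat_diff field_simps)
  qed
  moreover have "real l ^ (4 * r) = real l ^ (2 * r) * real l ^ r * real l ^ r"
    by (simp flip: power_add)
  moreover have "1 - 1 / real l \<noteq> 0" using l1 by auto
  moreover have "1 - 1 / (real l)\<^sup>2 \<noteq> 0" using one_minus_inverse_square_pos[OF l] by linarith
  ultimately show ?thesis
    unfolding card_GL2_mod[OF assms] using l1 by simp
qed

section \<open>Local densities\<close>

text \<open>Divisibility treats all discriminants alike: 0 has infinite valuation and is divisible
  by every power.\<close>

lemma val_less_iff:
  assumes "prime (l::nat)"
  shows "val l D < enat r \<longleftrightarrow> \<not> int l ^ r dvd D"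
proof (cases "D = 0")
  case False
  have "\<not> is_unit (int l)" using assms by auto
  then show ?thesis
    using False power_dvd_iff_le_multiplicity[of D "int l" r] by (simp add: val_def not_le)
qed (simp add: val_def)

text \<open>Up to exponent \<open>val l D + 1\<close> the two quadratics are congruent. At that
  exponent neither discriminant is divisible, so both counts have stabilised and still agree
  afterwards. For discriminant 0 the hypothesis covers all exponents.\<close>

lemma root_count_cong_pow:
  fixes t u u' :: int
  assumes l: "prime (l::nat)" and cong: "cong_pow l (val l (t\<^sup>2 - 4 * u) + 1) u' u"
  shows "root_count t u' (int l ^ j) = root_count t u (int l ^ j)"
proof -
  define D where "D = t\<^sup>2 - 4 * u"
  have close: "[u' = u] (mod int l ^ k)" if "enat k \<le> val l D + 1" for k
    using cong that by (simp add: cong_pow_def D_def)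
  show ?thesis
  proof (cases "enat j \<le> val l D + 1")
    case True
    then show ?thesis by (intro root_count_cong close)
  next
    case False
    then obtain e where e: "val l D = enat e" by (cases "val l D") auto
    have ej: "Suc e \<le> j" using False e by (simp add: one_enat_def)
    have c: "[u' = u] (mod int l ^ Suc e)" by (rule close) (simp add: e one_enat_def)
    have nd: "\<not> int l ^ Suc e dvd t\<^sup>2 - 4 * u"
      using val_less_iff[OF l, of D "Suc e"] e by (simp add: D_def)
    have "[t\<^sup>2 - 4 * u' = t\<^sup>2 - 4 * u] (mod int l ^ Suc e)"
      by (intro cong_diff cong_mult cong_refl c)
    then have nd': "\<not> int l ^ Suc e dvd t\<^sup>2 - 4 * u'"
      using nd cong_dvd_iff by blast
    show ?thesis
      using root_count_stable_le[OF l nd ej] root_count_stable_le[OF l nd' ej] root_count_cong[OF c] by simp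
  qed
qed

section \<open>The series of root densities: bounds and convergence\<close>

definition root_density :: "nat \<Rightarrow> int \<Rightarrow> int \<Rightarrow> nat \<Rightarrow> real" where
  "root_density l t u j = root_count t u (int l ^ j) / real l ^ j"

lemma root_density_nonneg: "root_density l t u j \<ge> 0"
  by (simp add: root_density_def root_count_nonneg)

lemma root_density_0 [simp]: "root_density l t u 0 = 1"
  by (simp add: root_density_def)

text \<open>One factor \<open>1 / l\<close> is kept as the relative error in (d); the others are
  relaxed to \<open>1 / 2\<close> to obtain constants uniform in \<open>l\<close>.\<close>

lemma root_density_Suc_le:
  assumes l: "prime (l::nat)"
  shows "root_density l t u (Suc j) \<le> 2 / real l * (1 / 2) ^ (j div 2)"
proof -
  have l2: "real l \<ge> 2" using prime_ge_2_nat[OF l] by simp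
  have "root_density l t u (Suc j) \<le> 2 * real l ^ (Suc j div 2) / real l ^ Suc j"
    unfolding root_density_def using l2 root_count_prime_power_le[OF l, of t u "Suc j"]
    by (intro divide_right_mono) auto
  \<comment> \<open>The second summand is \<open>Suc j / 2\<close> rounded up, the exponent left in
    the denominator after cancellation.\<close>
  also have "Suc j = Suc j div 2 + Suc (j div 2)" by linarith
  then have "real l ^ Suc j = real l ^ (Suc j div 2) * real l ^ Suc (j div 2)"
    by (metis power_add)
  also have "2 * real l ^ (Suc j div 2) / (real l ^ (Suc j div 2) * real l ^ Suc (j div 2))
      = 2 / real l * (1 / real l) ^ (j div 2)"
    using l2 by (simp add: power_one_over field_simps)
  also have "\<dots> \<le> 2 / real l * (1 / 2) ^ (j div 2)"
    using l2 by (intro mult_left_mono power_mono) (auto simp: field_simps)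
  finally show ?thesis .
qed

text \<open>Every power of \<open>1 / 2\<close> occurs twice, so the bound is twice the geometric
  series.\<close>

lemma sum_half_power_div_2_le: "(\<Sum>j<n. (1 / 2 :: real) ^ (j div 2)) \<le> 4"
proof -
  have "(\<Sum>j<2 * k. (1 / 2 :: real) ^ (j div 2)) = 4 - 4 * (1 / 2) ^ k" for k
    by (induction k) (simp_all add: field_simps)
  moreover have "(\<Sum>j<n. (1 / 2 :: real) ^ (j div 2)) \<le> (\<Sum>j<2 * n. (1 / 2 :: real) ^ (j div 2))"
    by (intro sum_mono2) auto
  ultimately show ?thesis by (smt (verit) zero_le_power divide_nonneg_nonneg)
qed

lemma sum_root_density_Suc_le:
  assumes l: "prime (l::nat)"
  shows "(\<Sum>j<n. root_density l t u (Suc j)) \<le> 8 / real l"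
proof -
  have "(\<Sum>j<n. root_density l t u (Suc j)) \<le> (\<Sum>j<n. 2 / real l * (1 / 2) ^ (j div 2))"
    by (intro sum_mono root_density_Suc_le l)
  also have "\<dots> = 2 / real l * (\<Sum>j<n. (1 / 2) ^ (j div 2))"
    by (simp only: sum_distrib_left)
  also have "\<dots> \<le> 2 / real l * 4"
    by (intro mult_left_mono sum_half_power_div_2_le) auto
  finally show ?thesis by simp
qed

lemma summable_root_density:
  assumes l: "prime (l::nat)"
  shows "summable (root_density l t u)"
proof -
  have "summable (\<lambda>j. root_density l t u (Suc j))"
    by (rule summableI_nonneg_bounded[OF root_density_nonneg sum_root_density_Suc_le[OF l]])
  then show ?thesis by (simp only: summable_Suc_iff)
qed

text \<open>Summation by parts: the left side comes from the matrix count, the right side is 1 plus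
  the differences of consecutive root counts as in (a), and also isolates the deviation from 1
  needed in (d).\<close>

lemma root_density_abel:
  "(1 - 1 / real l) * (\<Sum>i<r. root_density l t u i) + root_density l t u r =
    1 + (\<Sum>j<r. root_density l t u (Suc j)) - (\<Sum>i<r. root_density l t u i) / real l"
proof -
  have "(\<Sum>i<r. root_density l t u i) + root_density l t u r = 1 + (\<Sum>j<r. root_density l t u (Suc j))"
    using sum.lessThan_Suc_shift[of "root_density l t u" r] by simp
  then show ?thesis by (simp add: algebra_simps)
qed

lemma mat_count_close:
  assumes l: "prime (l::nat)"
  shows "\<bar>mat_count t u 1 (int l ^ r) - real l ^ (2 * r)\<bar> \<le> 8 * real l ^ (2 * r) / real l"
proof -
  define S where "S = (\<Sum>j<r. root_density l t u (Suc j))"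
  define S' where "S' = (\<Sum>i<r. root_density l t u i)"
  have l2: "real l \<ge> 2" using prime_ge_2_nat[OF l] by simp
  have S: "0 \<le> S" "S \<le> 8 / real l"
    unfolding S_def by (simp_all add: sum_nonneg root_density_nonneg sum_root_density_Suc_le l)
  \<comment> \<open>Here \<open>S \<le> 4\<close> gives \<open>S' \<le> 5\<close>; the weaker bound
    8 suffices to place \<open>S\<close> and \<open>S' / l\<close> in the same interval from 0 to
    \<open>8 / l\<close>, whose length bounds their difference.\<close>
  have "8 / real l \<le> 4" using l2 by (simp add: field_simps)
  moreover have "S' + root_density l t u r = 1 + S"
    using sum.lessThan_Suc_shift[of "root_density l t u" r] by (simp add: S_def S'_def)
  ultimately have "S' \<le> 8" using S(2) root_density_nonneg[of l t u r] by linarith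
  moreover have "0 \<le> S'" unfolding S'_def by (simp add: sum_nonneg root_density_nonneg)
  ultimately have S': "0 \<le> S' / real l" "S' / real l \<le> 8 / real l"
    by (simp_all add: divide_right_mono)
  have "mat_count t u 1 (int l ^ r) = real l ^ (2 * r) * (1 + S - S' / real l)"
    unfolding mat_count_prime_power[OF l] S_def S'_def
    by (subst root_density_abel[symmetric]) (simp add: root_density_def)
  then have "mat_count t u 1 (int l ^ r) - real l ^ (2 * r) = real l ^ (2 * r) * (S - S' / real l)"
    by (simp add: algebra_simps)
  then have "\<bar>mat_count t u 1 (int l ^ r) - real l ^ (2 * r)\<bar> = real l ^ (2 * r) * \<bar>S - S' / real l\<bar>"
    by (simp add: abs_mult)
  also have "\<dots> \<le> real l ^ (2 * r) * (8 / real l)"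
    using S S' by (intro mult_left_mono) auto
  finally show ?thesis by (simp add: mult.commute)
qed

text \<open>Write \<open>n\<close> as \<open>l ^ v * q\<close> with \<open>q\<close> prime to
  \<open>l\<close>: the first factor scales the modulus, the second acts as a unit.\<close>

lemma mat_count_scale_prime_power:
  assumes l: "prime (l::nat)" and "n \<ge> 1" "v = multiplicity l n" "w \<le> s"
  shows "mat_count (int n * t) ((int n)\<^sup>2 * u) (int l ^ (v + w)) (int l ^ (2 * v + s)) =
    real l ^ (3 * v) * mat_count t u (int l ^ w) (int l ^ s)"
proof -
  have l0: "int l > 0" using l prime_gt_0_nat by simp
  obtain q where q: "n = l ^ v * q" "\<not> l dvd q"
    using multiplicity_decompose'[of n l] assms l by (metis not_prime_unit not_one_le_zero mult.commute)
  have "coprime l q" using prime_imp_coprime[OF l q(2)] .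
  then have cq: "coprime (int q) (int l ^ s)" by (simp add: coprime_commute)
  have "mat_count (int n * t) ((int n)\<^sup>2 * u) (int l ^ (v + w)) (int l ^ (2 * v + s)) =
     mat_count (int l ^ v * (int q * t)) ((int l ^ v)\<^sup>2 * ((int q)\<^sup>2 * u)) (int l ^ v * int l ^ w) ((int l ^ v)\<^sup>2 * int l ^ s)"
    by (simp add: q(1) power_add power_mult_distrib mult_ac power_mult[symmetric])
  also have "\<dots> = of_int (int l ^ v) ^ 3 * mat_count (int q * t) ((int q)\<^sup>2 * u) (int l ^ w) (int l ^ s)"
    using l0 assms(4) by (intro mat_count_scale) (auto simp: le_imp_power_dvd)
  also have "mat_count (int q * t) ((int q)\<^sup>2 * u) (int l ^ w) (int l ^ s) = mat_count t u (int l ^ w) (int l ^ s)"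
    using l0 assms(4) cq by (intro mat_count_unit_scale) (auto simp: le_imp_power_dvd)
  finally show ?thesis by (simp add: mult.commute flip: power_mult)
qed

text \<open>By \<open>local_factor\<close>, this is the normalisation in the sequences defining \<open>f\<^sub>\<ell>\<close> and \<open>f\<^sup>*\<^sub>\<ell>\<close>.\<close>

definition mat_density :: "nat \<Rightarrow> nat \<Rightarrow> int \<Rightarrow> int \<Rightarrow> nat \<Rightarrow> real" where
  "mat_density l w t u r = mat_count t u (int l ^ w) (int l ^ r) / (real l ^ (2 * r) * (1 - 1 / (real l)\<^sup>2))"

lemma f_seq_1_eq:
  assumes "prime l" "r \<ge> 1"
  shows "f_seq t u 1 l r = mat_density l 0 t u r"
  unfolding f_seq_def mat_density_def local_factor[OF assms]
  using card_C_set_1[of l t u r] assms prime_gt_0_nat by simp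

lemma f_seq_eq:
  assumes "prime l" "r \<ge> 1" "multiplicity l n \<le> r"
  shows "f_seq t u n l r = mat_density l (multiplicity l n) (t - 2) (u + 1 - t) r"
  unfolding f_seq_def mat_density_def local_factor[OF assms(1,2)]
  using card_C_set[of l n r t u] assms prime_gt_0_nat by simp

lemma fstar_seq_eq:
  assumes "prime l" "r \<ge> 1"
  shows "fstar_seq t u l r = mat_density l 0 t u r - mat_density l 1 t u r"
  unfolding fstar_seq_def mat_density_def local_factor[OF assms]
  using card_C_set_nonzero[of l r t u] assms prime_gt_0_nat by (simp add: diff_divide_distrib)

text \<open>The count gains \<open>l ^ (3 * v)\<close>, the normalisation
  \<open>l ^ (4 * v)\<close>; the quotient is the factor in (b).\<close>

lemma mat_density_scale:
  assumes l: "prime (l::nat)" and "n \<ge> 1" "v = multiplicity l n" "w \<le> s"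
  shows "mat_density l (v + w) (int n * t) ((int n)\<^sup>2 * u) (2 * v + s) = mat_density l w t u s / real l ^ v"
proof -
  have l0: "real l > 0" using l prime_gt_0_nat by simp
  have "real l ^ (2 * (2 * v + s)) = real l ^ (3 * v) * (real l ^ v * real l ^ (2 * s))"
    by (simp add: algebra_simps flip: power_add)
  then show ?thesis
    unfolding mat_density_def mat_count_scale_prime_power[OF assms] using l0 by simp
qed

lemma mat_density_0:
  assumes l: "prime (l::nat)"
  shows "mat_density l 0 t u r =
    ((1 - 1 / real l) * (\<Sum>i<r. root_density l t u i) + root_density l t u r) / (1 - 1 / (real l)\<^sup>2)"
  using prime_gt_0_nat[OF l] mat_count_prime_power[OF l, of t u r]
  by (simp add: mat_density_def root_density_def)

lemma density_factor:
  assumes "real l > 1"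
  shows "(1 - 1 / real l) * x / (1 - 1 / (real l)\<^sup>2) = inverse (1 + 1 / real l) * x"
proof -
  have "1 - 1 / (real l)\<^sup>2 = (1 - 1 / real l) * (1 + 1 / real l)"
    using assms by (simp add: field_simps power2_eq_square)
  moreover have "1 - 1 / real l \<noteq> 0" using assms by auto
  ultimately show ?thesis by (simp add: divide_inverse)
qed

lemma mat_density_0_tendsto:
  assumes l: "prime (l::nat)"
  shows "mat_density l 0 t u \<longlonglongrightarrow> inverse (1 + 1 / real l) * (\<Sum>j. root_density l t u j)"
proof -
  have l1: "real l > 1" using prime_gt_1_nat[OF l] by simp
  have "(\<lambda>r. ((1 - 1 / real l) * (\<Sum>i<r. root_density l t u i) + root_density l t u r) / (1 - 1 / (real l)\<^sup>2))
      \<longlonglongrightarrow> ((1 - 1 / real l) * (\<Sum>j. root_density l t u j) + 0) / (1 - 1 / (real l)\<^sup>2)"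
  proof (intro tendsto_divide tendsto_add tendsto_mult tendsto_const)
    show "(\<lambda>r. \<Sum>i<r. root_density l t u i) \<longlonglongrightarrow> (\<Sum>j. root_density l t u j)"
      by (rule summable_LIMSEQ[OF summable_root_density[OF l]])
    show "root_density l t u \<longlonglongrightarrow> 0"
      by (rule summable_LIMSEQ_zero[OF summable_root_density[OF l]])
    show "1 - 1 / (real l)\<^sup>2 \<noteq> 0" using one_minus_inverse_square_pos[OF l] by linarith
  qed
  then show ?thesis
    unfolding mat_density_0[OF l, abs_def] by (simp only: add_0_right density_factor[OF l1])
qed

text \<open>Once the root count is stable, the next density is the previous one over
  \<open>l\<close>, and the boundary term loses exactly what the partial sum gains.\<close>

lemma mat_density_0_Suc:
  assumes l: "prime (l::nat)" and nd: "\<not> int l ^ r dvd t\<^sup>2 - 4 * u"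
  shows "mat_density l 0 t u (Suc r) = mat_density l 0 t u r"
proof -
  have "root_density l t u (Suc r) = root_density l t u r / real l"
    unfolding root_density_def root_count_stable[OF assms] by (simp add: mult.commute)
  then show ?thesis unfolding mat_density_0[OF l] by (simp add: algebra_simps)
qed

text \<open>Being constant from \<open>r\<close> on, the sequence equals its limit, so the tail of
  the series need not be evaluated.\<close>

lemma mat_density_0_const:
  assumes l: "prime (l::nat)" and nd: "\<not> int l ^ r dvd t\<^sup>2 - 4 * u"
  shows "mat_density l 0 t u r = inverse (1 + 1 / real l) * (\<Sum>j. root_density l t u j)"
proof -
  have "mat_density l 0 t u (k + r) = mat_density l 0 t u r" for k
  proof (induction k)
    case (Suc k)
    have "\<not> int l ^ (k + r) dvd t\<^sup>2 - 4 * u"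
      using nd by (meson dvd_trans le_imp_power_dvd le_add2)
    then show ?case using mat_density_0_Suc[OF l] Suc.IH by simp
  qed simp
  then have "(\<lambda>k. mat_density l 0 t u (k + r)) \<longlonglongrightarrow> mat_density l 0 t u r" by simp
  then have "mat_density l 0 t u \<longlonglongrightarrow> mat_density l 0 t u r" by (rule LIMSEQ_offset)
  then show ?thesis using mat_density_0_tendsto[OF l] LIMSEQ_unique by blast
qed

text \<open>A matrix divisible by \<open>l\<close> has trace and determinant divisible by
  \<open>l\<close>, hence also discriminant.\<close>

lemma mat_density_1_coprime_discriminant:
  assumes l: "prime (l::nat)" and nd: "\<not> int l dvd t\<^sup>2 - 4 * u" and "r \<ge> 1"
  shows "mat_density l 1 t u r = 0"
proof -
  have "\<not> mat_ok t u (int l) (int l ^ r) a b c" for a b c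
  proof
    assume ok: "mat_ok t u (int l) (int l ^ r) a b c"
    then have a: "int l dvd a" "int l dvd b" and ta: "int l dvd t - a"
      and "int l ^ r dvd a * (t - a) - b * c - u"
      by (auto simp: mat_ok_def)
    then have "int l dvd a * (t - a) - b * c - u"
      using assms(3) by (meson dvd_power dvd_trans not_one_le_zero le_eq_less_or_eq less_le_trans zero_less_one)
    then have "int l dvd (a * (t - a) - b * c) - (a * (t - a) - b * c - u)"
      by (rule dvd_diff[rotated]) (use a in auto)
    then have "int l dvd u" by simp
    moreover have "int l dvd (t - a) + a" using a ta by (intro dvd_add)
    then have "int l dvd t" by simp
    ultimately have "int l dvd t\<^sup>2 - 4 * u" by (intro dvd_diff) (auto simp: power2_eq_square)
    then show False using nd by blast
  qed
  then show ?thesis by (simp add: mat_density_def mat_count_def)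
qed

text \<open>The determinant of a matrix divisible by \<open>l\<close> is divisible by
  \<open>l\<^sup>2\<close>, which is visible modulo \<open>l ^ r\<close> once
  \<open>r \<ge> 2\<close>.\<close>

lemma mat_density_1_eq_0:
  assumes "\<not> (int l dvd t \<and> (int l)\<^sup>2 dvd u)" and "r \<ge> 2"
  shows "mat_density l 1 t u r = 0"
proof -
  have "\<not> mat_ok t u (int l) (int l ^ r) a b c" for a b c
  proof
    assume ok: "mat_ok t u (int l) (int l ^ r) a b c"
    then have a: "int l dvd a" "int l dvd b" "int l dvd c" "int l dvd t - a"
      and "int l ^ r dvd a * (t - a) - b * c - u"
      by (auto simp: mat_ok_def)
    then have "(int l)\<^sup>2 dvd a * (t - a) - b * c - u"
      using assms(2) by (meson le_imp_power_dvd dvd_trans)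
    moreover have "(int l)\<^sup>2 dvd a * (t - a) - b * c"
      unfolding power2_eq_square by (rule dvd_diff; rule mult_dvd_mono; rule a)
    ultimately have "(int l)\<^sup>2 dvd (a * (t - a) - b * c) - (a * (t - a) - b * c - u)"
      by (rule dvd_diff[rotated])
    then have "(int l)\<^sup>2 dvd u" by simp
    moreover have "int l dvd (t - a) + a" using a(4,1) by (rule dvd_add)
    then have "int l dvd t" by simp
    ultimately show False using assms(1) by blast
  qed
  then show ?thesis by (simp add: mat_density_def mat_count_def)
qed

lemma mat_density_1_descent:
  assumes l: "prime (l::nat)"
  shows "mat_density l 1 (int l * t) ((int l)\<^sup>2 * u) (2 + s) = mat_density l 0 t u s / real l"
proof -
  have "multiplicity l l = 1" using l by (intro multiplicity_self) auto
  then show ?thesis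
    using mat_density_scale[OF l, of l 1 0 s t u] prime_ge_1_nat[OF l] by simp
qed

text \<open>Either dividing by \<open>l\<close> descends to a convergent
  \<open>mat_density l 0\<close>, or the sequence vanishes from index 2 on. This includes
  discriminant 0, about which \<open>mat_density_1_const\<close> says nothing.\<close>

lemma convergent_mat_density_1:
  assumes l: "prime (l::nat)"
  shows "convergent (mat_density l 1 t u)"
proof (cases "int l dvd t \<and> (int l)\<^sup>2 dvd u")
  case True
  then obtain t' u' where tu: "t = int l * t'" "u = (int l)\<^sup>2 * u'" by blast
  have "(\<lambda>s. mat_density l 0 t' u' s / real l)
      \<longlonglongrightarrow> inverse (1 + 1 / real l) * (\<Sum>j. root_density l t' u' j) / real l"
    by (intro tendsto_divide mat_density_0_tendsto l tendsto_const) (use prime_gt_0_nat[OF l] in auto)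
  then have "(\<lambda>s. mat_density l 1 t u (s + 2))
      \<longlonglongrightarrow> inverse (1 + 1 / real l) * (\<Sum>j. root_density l t' u' j) / real l"
    using mat_density_1_descent[OF l, of t' u'] by (simp add: tu add.commute)
  then show ?thesis using LIMSEQ_offset convergentI by blast
next
  case False
  then have "(\<lambda>s. mat_density l 1 t u (s + 2)) \<longlonglongrightarrow> 0"
    using mat_density_1_eq_0[OF False] by simp
  then show ?thesis using LIMSEQ_offset convergentI by blast
qed

text \<open>If division by \<open>l\<close> is possible, the discriminant is
  \<open>l\<^sup>2\<close> times the descended one, so constancy is inherited with the index lowered
  by 2. Otherwise the density is 0 at both indices.\<close>

lemma mat_density_1_const:
  assumes l: "prime (l::nat)" and nd: "\<not> int l ^ r dvd t\<^sup>2 - 4 * u" "\<not> int l ^ r' dvd t\<^sup>2 - 4 * u"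
  shows "mat_density l 1 t u r = mat_density l 1 t u r'"
proof -
  have r1: "r \<ge> 1" "r' \<ge> 1" using nd by (auto intro!: Suc_leI gr0I)
  consider (a) "\<not> int l dvd t\<^sup>2 - 4 * u" | (b) "int l dvd t\<^sup>2 - 4 * u" "int l dvd t \<and> (int l)\<^sup>2 dvd u"
    | (c) "int l dvd t\<^sup>2 - 4 * u" "\<not> (int l dvd t \<and> (int l)\<^sup>2 dvd u)" by blast
  then show ?thesis
  proof cases
    case a
    then show ?thesis using mat_density_1_coprime_discriminant[OF l a] r1 by simp
  next
    case b
    then obtain t' u' where tu: "t = int l * t'" "u = (int l)\<^sup>2 * u'" by blast
    have D: "t\<^sup>2 - 4 * u = (int l)\<^sup>2 * (t'\<^sup>2 - 4 * u')"
      by (simp add: tu power_mult_distrib algebra_simps)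
    have *: "mat_density l 1 t u k = inverse (1 + 1 / real l) * (\<Sum>j. root_density l t' u' j) / real l"
      if k: "\<not> int l ^ k dvd t\<^sup>2 - 4 * u" for k
    proof -
      have "2 \<le> k"
      proof (rule ccontr)
        assume "\<not> 2 \<le> k"
        then have "int l ^ k dvd (int l)\<^sup>2" by (intro le_imp_power_dvd) simp
        then show False using k D by simp
      qed
      then obtain s where s: "k = 2 + s" using le_Suc_ex by blast
      have "\<not> int l ^ s dvd t'\<^sup>2 - 4 * u'"
        using k unfolding D s power_add by (metis dvd_refl mult_dvd_mono)
      then show ?thesis
        unfolding s tu mat_density_1_descent[OF l] using mat_density_0_const[OF l] by simp
    qed
    show ?thesis using *[OF nd(1)] *[OF nd(2)] by simp
  next
    case c
    \<comment> \<open>Since \<open>l\<close> divides the discriminant, index 1 is excluded and the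
      vanishing from index 2 on applies.\<close>
    have "r \<noteq> 1" "r' \<noteq> 1" using nd c by auto
    then show ?thesis using mat_density_1_eq_0[OF c(2)] r1 by simp
  qed
qed

text \<open>Stability makes the terms with \<open>j > val l D + 1\<close> vanish, so the sum may be
  extended to all \<open>j \<le> r\<close>, where summation by parts applies.\<close>

lemma card_C_set_1_eq_sum:
  fixes t u u' :: int
  assumes l: "prime (l::nat)" and D: "D = t\<^sup>2 - 4 * u" and cong: "cong_pow l (val l D + 1) u' u"
  shows "real (card (C_set t u' 1 l r)) =
    real l ^ (2 * r) + real l ^ (2 * r) *
      (\<Sum>j | 1 \<le> j \<and> enat j \<le> min (enat r) (val l D + 1).
         (real (num_sqrt D (l ^ j)) - real (num_sqrt D (l ^ (j - 1)))) / real l ^ j)"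
proof -
  define g where "g = (\<lambda>j. (real (num_sqrt D (l ^ j)) - real (num_sqrt D (l ^ (j - 1)))) / real l ^ j)"
  have l0: "l > 0" using prime_gt_0_nat[OF l] .
  have num: "real (num_sqrt D (l ^ j)) = root_count t u (int l ^ j)" for j
    using num_sqrt_eq_root_count[of "l ^ j" t u] l0 by (simp add: D)
  have rd: "root_density l t u' = root_density l t u"
    unfolding root_density_def using root_count_cong_pow[OF l, of t u u'] cong D by auto
  have g: "g (Suc j) = root_density l t u (Suc j) - root_density l t u j / real l" for j
    using l0 by (simp add: g_def num root_density_def diff_divide_distrib mult.commute)
  have "(\<Sum>j | 1 \<le> j \<and> enat j \<le> min (enat r) (val l D + 1). g j) = (\<Sum>j\<in>{1..r}. g j)"
  proof (rule sum.mono_neutral_left)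
    show "\<forall>j\<in>{1..r} - {j. 1 \<le> j \<and> enat j \<le> min (enat r) (val l D + 1)}. g j = 0"
    proof
      fix j assume "j \<in> {1..r} - {j. 1 \<le> j \<and> enat j \<le> min (enat r) (val l D + 1)}"
      then have j: "1 \<le> j" and gt: "val l D + 1 < enat j" by auto
      obtain i where i: "j = Suc i" using j by (cases j) auto
      have "val l D < enat i" using gt by (cases "val l D") (auto simp: i one_enat_def)
      then have "\<not> int l ^ i dvd t\<^sup>2 - 4 * u" using val_less_iff[OF l] D by simp
      then show "g j = 0" unfolding i g_def num using root_count_stable[OF l] by simp
    qed
  qed auto
  also have "\<dots> = (\<Sum>j<r. g (Suc j))"
    by (simp add: sum.atLeast1_atMost_eq)
  also have "\<dots> = (\<Sum>j<r. root_density l t u (Suc j)) - (\<Sum>j<r. root_density l t u j) / real l"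
    unfolding g by (simp add: sum_subtractf sum_divide_distrib)
  finally have "1 + (\<Sum>j | 1 \<le> j \<and> enat j \<le> min (enat r) (val l D + 1). g j) =
      (1 - 1 / real l) * (\<Sum>i<r. root_density l t u' i) + root_density l t u' r"
    unfolding root_density_abel rd by simp
  then have "real (card (C_set t u' 1 l r)) =
      real l ^ (2 * r) * (1 + (\<Sum>j | 1 \<le> j \<and> enat j \<le> min (enat r) (val l D + 1). g j))"
    unfolding card_C_set_1[OF l0] mat_count_prime_power[OF l] by (simp add: root_density_def)
  then show ?thesis unfolding g_def by (simp only: distrib_left mult_1_right)
qed

lemma f_seq_tendsto:
  assumes l: "prime (l::nat)"
  shows "f_seq t u 1 l \<longlonglongrightarrow> inverse (1 + 1 / real l) * (\<Sum>j. root_density l t u j)"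
proof -
  \<comment> \<open>The shift avoids \<open>r = 0\<close>, where the formula for the group order
    does not apply.\<close>
  have "(\<lambda>r. f_seq t u 1 l (r + 1)) \<longlonglongrightarrow> inverse (1 + 1 / real l) * (\<Sum>j. root_density l t u j)"
    using LIMSEQ_ignore_initial_segment[OF mat_density_0_tendsto[OF l, of t u], of 1]
    by (simp add: f_seq_1_eq[OF l] del: One_nat_def)
  then show ?thesis by (rule LIMSEQ_offset)
qed

lemma f_seq_const:
  fixes t u u' :: int
  assumes l: "prime (l::nat)" and D: "D = t\<^sup>2 - 4 * u" and cong: "cong_pow l (val l D + 1) u' u"
    and r: "val l D < enat r" "r \<ge> 1"
  shows "f_seq t u' 1 l r = inverse (1 + 1 / real l) * (\<Sum>j. root_density l t u j)"
proof -
  have "\<not> int l ^ r dvd t\<^sup>2 - 4 * u" using r val_less_iff[OF l] D by simp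
  then have "mat_density l 0 t u r = inverse (1 + 1 / real l) * (\<Sum>j. root_density l t u j)"
    by (rule mat_density_0_const[OF l])
  moreover have "root_density l t u' = root_density l t u"
    unfolding root_density_def using root_count_cong_pow[OF l, of t u u'] cong D by auto
  then have "mat_density l 0 t u' r = mat_density l 0 t u r"
    unfolding mat_density_0[OF l] by simp
  ultimately show ?thesis using f_seq_1_eq[OF l r(2)] by simp
qed

lemma card_C_set_le: "card (C_set t u n l r) \<le> l ^ (4 * r)"
proof -
  have "real (card (mat2_mod (l ^ r))) = real (l ^ r) ^ 4"
    using card_mat2_mod[of "l ^ r" "\<lambda>_ _ _ _. True"] by (simp add: eval_nat_numeral)
  then have "real (card (mat2_mod (l ^ r))) = real (l ^ (4 * r))"
    by (simp add: mult.commute flip: power_mult)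
  then have "card (mat2_mod (l ^ r)) = l ^ (4 * r)" by linarith
  moreover have "card (C_set t u n l r) \<le> card (mat2_mod (l ^ r))"
    by (intro card_mono finite_mat2_mod) (auto simp: C_set_def)
  ultimately show ?thesis by simp
qed

text \<open>The density is already constant from \<open>r = 1\<close>, so the whole series is
  evaluated from the roots modulo \<open>l\<close>.\<close>

lemma mat_density_0_coprime_discriminant:
  assumes l: "prime (l::nat)" and nd: "\<not> int l dvd t\<^sup>2 - 4 * u"
  shows "inverse (1 + 1 / real l) * (\<Sum>j. root_density l t u j) =
    inverse (1 - 1 / (real l)\<^sup>2) * (1 + of_int (kronecker (t\<^sup>2 - 4 * u) l) / real l)"
proof -
  have "inverse (1 + 1 / real l) * (\<Sum>j. root_density l t u j) = mat_density l 0 t u 1"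
    using mat_density_0_const[OF l, of 1 t u] nd by simp
  also have "\<dots> = ((1 - 1 / real l) + (1 + of_int (kronecker (t\<^sup>2 - 4 * u) l)) / real l) / (1 - 1 / (real l)\<^sup>2)"
    unfolding mat_density_0[OF l] using kronecker_root_count[OF l nd] by (simp add: root_density_def)
  also have "\<dots> = inverse (1 - 1 / (real l)\<^sup>2) * (1 + of_int (kronecker (t\<^sup>2 - 4 * u) l) / real l)"
    by (simp add: divide_inverse algebra_simps)
  finally show ?thesis .
qed

section \<open>Descent from level \<open>n\<close> to level 1 via \<open>(A - 1) / n\<close>, of
  trace \<open>t1\<close> and determinant \<open>u1\<close>\<close>

context
  fixes t u :: int and n l v :: nat and t1 u1 :: int
  assumes l: "prime l" and n: "n \<ge> 1" and v: "v = multiplicity l n"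
    and t1: "t - 2 = int n * t1" and u1: "u + 1 - t = (int n)\<^sup>2 * u1"
begin

lemma f_seq_descent:
  assumes "s \<ge> 1"
  shows "f_seq t u n l (2 * v + s) = mat_density l 0 t1 u1 s / real l ^ v"
  using f_seq_eq[OF l, of "2 * v + s" n t u] mat_density_scale[OF l n v, of 0 s t1 u1] assms
  by (simp add: v[symmetric] t1 u1)

text \<open>The extra factor \<open>l\<close> turns into divisibility by \<open>l\<close> of the
  descended matrix, exactly the matrices that \<open>fstar_seq\<close> omits.\<close>

lemma f_seq_descent_mult:
  assumes "s \<ge> 1"
  shows "f_seq t u (l * n) l (2 * v + s) = mat_density l 1 t1 u1 s / real l ^ v"
proof -
  have "multiplicity l (l * n) = Suc v"
    using l n v by (intro multiplicity_times_same[THEN trans]) (auto simp: prime_gt_0_nat)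
  then show ?thesis
    using f_seq_eq[OF l, of "2 * v + s" "l * n" t u] mat_density_scale[OF l n v, of 1 s t1 u1] assms
    by (simp add: t1 u1)
qed

text \<open>Subtracting the identity preserves the discriminant; dividing by \<open>n\<close>
  divides it by \<open>n\<^sup>2\<close>.\<close>

lemma discriminant_descent: "t\<^sup>2 - 4 * u = (int n)\<^sup>2 * (t1\<^sup>2 - 4 * u1)"
proof -
  have "t\<^sup>2 - 4 * u = (t - 2)\<^sup>2 - 4 * (u + 1 - t)" by (simp add: power2_eq_square algebra_simps)
  then show ?thesis unfolding t1 u1 by (simp add: power_mult_distrib algebra_simps)
qed

text \<open>The discriminant is divisible by \<open>l ^ (2 * v)\<close>, so an index beyond its
  valuation has the form \<open>2 * v + s\<close> with \<open>s\<close> beyond the valuation of the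
  descended discriminant.\<close>

lemma const_beyond_f_seq: "const_beyond (val l (t\<^sup>2 - 4 * u)) (f_seq t u n l)"
proof -
  have "f_seq t u n l r = inverse (1 + 1 / real l) * (\<Sum>j. root_density l t1 u1 j) / real l ^ v"
    if r: "val l (t\<^sup>2 - 4 * u) < enat r" for r
  proof -
    have nd: "\<not> int l ^ r dvd (int n)\<^sup>2 * (t1\<^sup>2 - 4 * u1)"
      using r val_less_iff[OF l] discriminant_descent by simp
    have "int l ^ v dvd int n"
      using multiplicity_dvd[of l n] v by (metis of_nat_dvd_iff of_nat_power)
    then have ln: "int l ^ (2 * v) dvd (int n)\<^sup>2"
      by (metis dvd_power_same mult.commute power_mult)
    have "2 * v < r"
    proof (rule ccontr)
      assume "\<not> 2 * v < r"
      then have "int l ^ r dvd (int n)\<^sup>2" using ln by (meson dvd_trans le_imp_power_dvd not_less)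
      then show False using nd by simp
    qed
    then obtain s where s: "r = 2 * v + s" "s \<ge> 1"
      by (metis less_imp_add_positive Suc_leI One_nat_def)
    have "\<not> int l ^ s dvd t1\<^sup>2 - 4 * u1"
      using nd ln mult_dvd_mono unfolding s(1) power_add by blast
    then show ?thesis
      unfolding s(1) f_seq_descent[OF s(2)] using mat_density_0_const[OF l] by simp
  qed
  then show ?thesis by (auto simp: const_beyond_def)
qed

lemma descent_tendsto:
  assumes "\<And>s. s \<ge> 1 \<Longrightarrow> X (2 * v + s) = Y s / real l ^ v" "Y \<longlonglongrightarrow> y"
  shows "X \<longlonglongrightarrow> y / real l ^ v"
proof -
  have "(\<lambda>s. Y (s + 1) / real l ^ v) \<longlonglongrightarrow> y / real l ^ v"
    using LIMSEQ_ignore_initial_segment[OF assms(2), of 1] prime_gt_0_nat[OF l]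
    by (intro tendsto_divide tendsto_const) auto
  moreover have "Y (s + 1) / real l ^ v = X (s + (2 * v + 1))" for s
    using assms(1)[of "s + 1"] by (simp add: algebra_simps)
  ultimately show ?thesis using LIMSEQ_offset[of X "2 * v + 1"] by simp
qed

text \<open>Descent multiplies both the main term and the error of \<open>mat_count_close\<close> by
  \<open>l ^ (3 * v)\<close>; with \<open>r = 2 * v + s\<close> the exponent
  \<open>3 * v + 2 * s\<close> is \<open>2 * r - v\<close>.\<close>

lemma card_C_set_close:
  assumes "2 * v \<le> r"
  shows "\<bar>real (card (C_set t u n l r)) - real l powi (2 * int r - int v)\<bar>
    \<le> 8 * real l powi (2 * int r - int v - 1)"
proof -
  obtain s where s: "r = 2 * v + s" using assms le_Suc_ex by blast
  have l0: "real l > 0" using prime_gt_0_nat[OF l] by simp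
  have "real (card (C_set t u n l r)) = real l ^ (3 * v) * mat_count t1 u1 1 (int l ^ s)"
    using card_C_set[of l n r t u] mat_count_scale_prime_power[OF l n v, of 0 s t1 u1] prime_gt_0_nat[OF l]
    by (simp add: v[symmetric] t1 u1 s)
  moreover have "2 * int r - int v = int (3 * v + 2 * s)" by (simp add: s)
  then have p: "real l powi (2 * int r - int v) = real l ^ (3 * v) * real l ^ (2 * s)"
    by (simp only: power_int_of_nat power_add)
  moreover have "real l powi (2 * int r - int v - 1) = real l ^ (3 * v) * (real l ^ (2 * s) / real l)"
    using l0 p by (simp add: power_int_diff)
  ultimately have "\<bar>real (card (C_set t u n l r)) - real l powi (2 * int r - int v)\<bar>
      = real l ^ (3 * v) * \<bar>mat_count t1 u1 1 (int l ^ s) - real l ^ (2 * s)\<bar>"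
    by (simp add: abs_mult flip: right_diff_distrib)
  also have "\<dots> \<le> real l ^ (3 * v) * (8 * real l ^ (2 * s) / real l)"
    by (intro mult_left_mono mat_count_close l) simp
  also have "\<dots> = 8 * real l powi (2 * int r - int v - 1)"
    using l0 p by (simp add: power_int_diff)
  finally show ?thesis .
qed

text \<open>Count and main term are both at most \<open>l ^ (4 * r)\<close>. Splitting off the error
  exponent \<open>2 * r - v - 1\<close> leaves \<open>2 * r + v + 1\<close>, which is at most
  \<open>5 * v\<close> for \<open>r < 2 * v\<close>, and \<open>l ^ v \<le> n\<close>.\<close>

lemma card_C_set_crude:
  assumes "r < 2 * v"
  shows "\<bar>real (card (C_set t u n l r)) - real l powi (2 * int r - int v)\<bar>
    \<le> real n ^ 5 * real l powi (2 * int r - int v - 1)"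
proof -
  have l1: "real l \<ge> 1" using prime_ge_1_nat[OF l] by simp
  have pos: "real l powi k > 0" for k using l1 by (intro zero_less_power_int) auto
  have "real (card (C_set t u n l r)) \<le> real (l ^ (4 * r))"
    using card_C_set_le of_nat_mono by blast
  also have "\<dots> = real l powi (4 * int r)"
    using power_int_of_nat[of "real l" "4 * r"] by simp
  finally have card: "real (card (C_set t u n l r)) \<le> real l powi (4 * int r)" .
  have "real l powi (2 * int r - int v) \<le> real l powi (4 * int r)"
    using l1 by (intro power_int_increasing) auto
  then have "\<bar>real (card (C_set t u n l r)) - real l powi (2 * int r - int v)\<bar> \<le> real l powi (4 * int r)"
    using card pos[of "2 * int r - int v"] by linarith
  also have "\<dots> = real l powi (2 * int r + int v + 1) * real l powi (2 * int r - int v - 1)"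
    using l1 by (simp flip: power_int_add)
  also have "\<dots> \<le> real l powi (5 * int v) * real l powi (2 * int r - int v - 1)"
    using l1 assms pos less_imp_le by (intro mult_right_mono power_int_increasing) auto
  also have "real l powi (5 * int v) = real (l ^ v) ^ 5"
    using power_int_of_nat[of "real l" "5 * v"] by (simp add: mult.commute flip: power_mult)
  also have "\<dots> * real l powi (2 * int r - int v - 1) \<le> real n ^ 5 * real l powi (2 * int r - int v - 1)"
  proof -
    have "l ^ v \<le> n" using multiplicity_dvd[of l n] v n by (auto intro: dvd_imp_le)
    then show ?thesis using pos less_imp_le by (intro mult_right_mono power_mono of_nat_mono) auto
  qed
  finally show ?thesis .
qed

end

theorem theorem3p2:
  shows "\<exists>(K :: real) (K' :: nat \<Rightarrow> real). \<forall>(t :: int) (u :: int) (D :: int) (n :: nat) (l :: nat) (t1 :: int) (u1 :: int) (v :: nat).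
    D = t\<^sup>2 - 4 * u \<and> n \<ge> 1 \<and> [u = 1] (mod int n) \<and> [u + 1 = t] (mod (int n)\<^sup>2) \<and> prime l \<and>
    t1 = (t - 2) div int n \<and> u1 = (u + 1 - t) div (int n)\<^sup>2 \<and> v = multiplicity l n
    \<longrightarrow>
    \<comment> \<open>(a)\<close>
    ((\<forall>r\<ge>1. \<forall>u'. cong_pow l (val l D + 1) u' u \<longrightarrow>
        real (card (C_set t u' 1 l r)) =
          real l ^ (2 * r) + real l ^ (2 * r) *
            (\<Sum>j | 1 \<le> j \<and> enat j \<le> min (enat r) (val l D + 1).
               (real (num_sqrt D (l ^ j)) - real (num_sqrt D (l ^ (j - 1)))) / real l ^ j) \<and>
        (val l D < enat r \<longrightarrow>
          f_seq t u' 1 l r =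
            inverse (1 + 1 / real l) * (\<Sum>j. real (num_sqrt D (l ^ j)) / real l ^ j))) \<and>
     summable (\<lambda>j. real (num_sqrt D (l ^ j)) / real l ^ j) \<and>
     convergent (f_seq t u 1 l) \<and>
     f_loc t u 1 l =
       inverse (1 + 1 / real l) * (\<Sum>j. real (num_sqrt D (l ^ j)) / real l ^ j)) \<and>
    \<comment> \<open>(b)\<close>
    (const_beyond (val l D) (f_seq t u n l) \<and>
     convergent (f_seq t u n l) \<and>
     convergent (f_seq t u (l * n) l) \<and>
     convergent (f_seq t1 u1 1 l) \<and>
     convergent (fstar_seq t1 u1 l) \<and>
     f_loc t u n l = f_loc t1 u1 1 l / real l ^ v \<and>
     f_loc t u n l - f_loc t u (l * n) l = fstar_loc t1 u1 l / real l ^ v \<and>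
     const_beyond (val l (t1\<^sup>2 - 4 * u1)) (fstar_seq t1 u1 l)) \<and>
    \<comment> \<open>(c)\<close>
    (\<not> int l dvd D div (int n)\<^sup>2 \<longrightarrow>
       f_loc t u (l * n) l = 0 \<and>
       f_loc t u n l =
         1 / real l ^ v * inverse (1 - 1 / (real l)\<^sup>2) *
         (1 + real_of_int (kronecker (D div (int n)\<^sup>2) l) / real l)) \<and>
    \<comment> \<open>(d): for \<open>r < 2 * v\<close> no constant uniform in \<open>n\<close> exists\<close>
    (\<forall>r\<ge>1.
       \<bar>real (card (C_set t u n l r)) - real l powi (2 * int r - int v)\<bar>
         \<le> K' n * real l powi (2 * int r - int v - 1) \<and>
       (2 * v \<le> r \<longrightarrow>
         \<bar>real (card (C_set t u n l r)) - real l powi (2 * int r - int v)\<bar>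
           \<le> K * real l powi (2 * int r - int v - 1)))"
\<comment> \<open>The constant 8 is that of \<open>mat_count_close\<close>; \<open>n ^ 5\<close> is
  that of the crude bound for \<open>r < 2 * v\<close>, and their sum serves every
  \<open>r\<close>.\<close>
proof (intro exI[of _ "8 :: real"] exI[of _ "\<lambda>n. 8 + real n ^ 5"] allI impI, elim conjE, goal_cases)
  case (1 t u D n l t1 u1 v)
  then have D: "D = t\<^sup>2 - 4 * u" and n: "n \<ge> 1" and un: "[u = 1] (mod int n)"
    and utn: "[u + 1 = t] (mod (int n)\<^sup>2)" and l: "prime l"
    and t1': "t1 = (t - 2) div int n" and u1': "u1 = (u + 1 - t) div (int n)\<^sup>2" and v: "v = multiplicity l n"
    by blast+
  have dvd_u1: "(int n)\<^sup>2 dvd u + 1 - t" using utn by (simp add: cong_iff_dvd_diff)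
  then have u1: "u + 1 - t = (int n)\<^sup>2 * u1" by (simp add: u1')
  \<comment> \<open>The difference of \<open>u - 1\<close> and \<open>u + 1 - t\<close> is
    \<open>t - 2\<close>, so the division defining \<open>t1\<close> is exact.\<close>
  have "int n dvd u + 1 - t" using dvd_u1 unfolding power2_eq_square by (rule dvd_mult_left)
  moreover have "int n dvd u - 1" using un by (simp add: cong_iff_dvd_diff)
  ultimately have "int n dvd (u - 1) - (u + 1 - t)" by (rule dvd_diff[rotated])
  then have "int n dvd t - 2" by simp
  then have t1: "t - 2 = int n * t1" by (simp add: t1')
  note ctx = l n v t1 u1
  \<comment> \<open>Limits at level 1: \<open>h\<close> for all matrices, \<open>h1\<close> for
    those divisible by \<open>l\<close>, hence \<open>h - h1\<close> for
    \<open>fstar_seq\<close>.\<close>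
  define h where "h = inverse (1 + 1 / real l) * (\<Sum>j. root_density l t1 u1 j)"
  obtain h1 where h1: "mat_density l 1 t1 u1 \<longlonglongrightarrow> h1"
    using convergent_mat_density_1[OF l] by (auto simp: convergent_def)
  have num: "(\<lambda>j. real (num_sqrt D (l ^ j)) / real l ^ j) = root_density l t u"
    using num_sqrt_eq_root_count[of "l ^ _" t u] prime_gt_0_nat[OF l] by (simp add: fun_eq_iff root_density_def D)
  have D1: "D div (int n)\<^sup>2 = t1\<^sup>2 - 4 * u1"
    using discriminant_descent[OF ctx] n by (simp add: D)
  have lim_n: "f_seq t u n l \<longlonglongrightarrow> h / real l ^ v"
    using descent_tendsto[OF ctx f_seq_descent[OF ctx] mat_density_0_tendsto[OF l]] by (simp add: h_def)
  have lim_ln: "f_seq t u (l * n) l \<longlonglongrightarrow> h1 / real l ^ v"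
    using descent_tendsto[OF ctx f_seq_descent_mult[OF ctx] h1] by simp
  have lim_1: "f_seq t1 u1 1 l \<longlonglongrightarrow> h"
    using f_seq_tendsto[OF l] by (simp add: h_def)
  have lim_star: "fstar_seq t1 u1 l \<longlonglongrightarrow> h - h1"
  proof -
    have "(\<lambda>r. mat_density l 0 t1 u1 r - mat_density l 1 t1 u1 r) \<longlonglongrightarrow> h - h1"
      using mat_density_0_tendsto[OF l] h1 unfolding h_def by (rule tendsto_diff)
    then have "(\<lambda>r. fstar_seq t1 u1 l (r + 1)) \<longlonglongrightarrow> h - h1"
      using LIMSEQ_ignore_initial_segment[of "\<lambda>r. mat_density l 0 t1 u1 r - mat_density l 1 t1 u1 r" "h - h1" 1]
      by (simp add: fstar_seq_eq[OF l])
    then show ?thesis by (rule LIMSEQ_offset)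
  qed
  have star_const: "const_beyond (val l (t1\<^sup>2 - 4 * u1)) (fstar_seq t1 u1 l)"
    unfolding const_beyond_def val_less_iff[OF l]
  proof (intro allI impI, elim conjE)
    fix r r' assume nd: "\<not> int l ^ r dvd t1\<^sup>2 - 4 * u1" "\<not> int l ^ r' dvd t1\<^sup>2 - 4 * u1"
    then have "r \<ge> 1" "r' \<ge> 1" by (auto intro!: Suc_leI gr0I)
    then show "fstar_seq t1 u1 l r = fstar_seq t1 u1 l r'"
      using mat_density_1_const[OF l nd] mat_density_0_const[OF l] nd by (simp add: fstar_seq_eq[OF l])
  qed
  have c: "f_loc t u (l * n) l = 0 \<and> f_loc t u n l =
      1 / real l ^ v * inverse (1 - 1 / (real l)\<^sup>2) * (1 + real_of_int (kronecker (D div (int n)\<^sup>2) l) / real l)"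
    if "\<not> int l dvd D div (int n)\<^sup>2"
  proof
    have nd: "\<not> int l dvd t1\<^sup>2 - 4 * u1" using that D1 by simp
    have "(\<lambda>r. mat_density l 1 t1 u1 (r + 1)) \<longlonglongrightarrow> 0"
      using mat_density_1_coprime_discriminant[OF l nd] by simp
    then have "h1 = 0" using LIMSEQ_offset h1 LIMSEQ_unique by blast
    then show "f_loc t u (l * n) l = 0" using limI[OF lim_ln] by (simp add: f_loc_def)
    show "f_loc t u n l = 1 / real l ^ v * inverse (1 - 1 / (real l)\<^sup>2) *
        (1 + real_of_int (kronecker (D div (int n)\<^sup>2) l) / real l)"
      using limI[OF lim_n] mat_density_0_coprime_discriminant[OF l nd]
      by (simp add: f_loc_def h_def D1)
  qed
  have d: "\<bar>real (card (C_set t u n l r)) - real l powi (2 * int r - int v)\<bar>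
       \<le> (8 + real n ^ 5) * real l powi (2 * int r - int v - 1) \<and>
     (2 * v \<le> r \<longrightarrow> \<bar>real (card (C_set t u n l r)) - real l powi (2 * int r - int v)\<bar>
         \<le> 8 * real l powi (2 * int r - int v - 1))" for r
  proof (cases "2 * v \<le> r")
    case True
    have "0 \<le> real n ^ 5 * real l powi (2 * int r - int v - 1)" by simp
    then show ?thesis unfolding distrib_right using card_C_set_close[OF ctx True] by linarith
  next
    case False
    then have "r < 2 * v" by simp
    moreover have "0 \<le> 8 * real l powi (2 * int r - int v - 1)" by simp
    ultimately show ?thesis
      unfolding distrib_right using card_C_set_crude[OF ctx, of r] False by linarith
  qed
  have a: "\<forall>r\<ge>1. \<forall>u'. cong_pow l (val l D + 1) u' u \<longrightarrow>
        real (card (C_set t u' 1 l r)) =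
          real l ^ (2 * r) + real l ^ (2 * r) *
            (\<Sum>j | 1 \<le> j \<and> enat j \<le> min (enat r) (val l D + 1).
               (real (num_sqrt D (l ^ j)) - real (num_sqrt D (l ^ (j - 1)))) / real l ^ j) \<and>
        (val l D < enat r \<longrightarrow>
          f_seq t u' 1 l r =
            inverse (1 + 1 / real l) * (\<Sum>j. real (num_sqrt D (l ^ j)) / real l ^ j))"
    unfolding num using card_C_set_1_eq_sum[OF l D] f_seq_const[OF l D] by blast
  have lim_t: "f_seq t u 1 l \<longlonglongrightarrow>
      inverse (1 + 1 / real l) * (\<Sum>j. real (num_sqrt D (l ^ j)) / real l ^ j)"
    unfolding num by (rule f_seq_tendsto[OF l])
  have summable: "summable (\<lambda>j. real (num_sqrt D (l ^ j)) / real l ^ j)"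
    unfolding num by (rule summable_root_density[OF l])
  have const: "const_beyond (val l D) (f_seq t u n l)"
    unfolding D by (rule const_beyond_f_seq[OF ctx])
  have b1: "f_loc t u n l = f_loc t1 u1 1 l / real l ^ v"
    using limI[OF lim_n] limI[OF lim_1] by (simp add: f_loc_def)
  have b2: "f_loc t u n l - f_loc t u (l * n) l = fstar_loc t1 u1 l / real l ^ v"
    using limI[OF lim_n] limI[OF lim_ln] limI[OF lim_star]
    by (simp add: f_loc_def fstar_loc_def diff_divide_distrib)
  show ?case
    using a summable convergentI[OF lim_t] limI[OF lim_t, folded f_loc_def] const convergentI[OF lim_n]
      convergentI[OF lim_ln] convergentI[OF lim_1] convergentI[OF lim_star] b1 b2 star_const c d
    by (intro conjI impI allI) (assumption | blast)+
qed

end
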